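(* There are infinitely many generalized Wallach spaces $G/H$ such that on each of them every generic invariant metric with positive Ricci curvature preserves the positivity of the Ricci curvature under the normalized Ricci flow. That is: for each of these spaces, with parameters $(a_1,a_2,a_3)$, and for every initial point $\mathbf{x}(0)\in\mathscr{R}_+$ with pairwise distinct coordinates $x_1(0),x_2(0),x_3(0)$, if $\mathbf{x}(t)$, $t\in[0,T)$, denotes the maximal solution of the normalized Ricci flow system starting at $\mathbf{x}(0)$, then $\mathbf{x}(t)\in\mathscr{R}_+$ for all $t\in(0,T)$.
   Context: A generalized Wallach space (GWS) is a homogeneous space $G/H$, where $G$ is a compact (semisimple) Lie group with Lie algebra $\mathfrak{g}$ and $H$ is a closed subgroup with Lie algebra $\mathfrak{h}$, such that the orthogonal complement $\mathfrak{p}$ of $\mathfrak{h}$ in $\mathfrak{g}$ with respect to $\langle\cdot,\cdot\rangle=-B(\cdot,\cdot)$ ($B$ the Killing form of $\mathfrak{g}$) decomposes as an orthogonal direct sum $\mathfrak{p}=\mathfrak{p}_1\oplus\mathfrak{p}_2\oplus\mathfrak{p}_3$ of three irreducible $\mathrm{Ad}(H)$-modules satisfying $[\mathfrak{p}_i,\mathfrak{p}_i]\subset\mathfrak{h}$ for each $i\in\{1,2,3\}$. Spaces are counted up to isomorphism of the pair $(\mathfrak{g},\mathfrak{h})$. Each GWS is described by a triple $(a_1,a_2,a_3)\in(0,1/2]^3$, given by $a_i=A/d_i$, where $d_i=\dim\mathfrak{p}_i$ and $A=\sum_{\alpha,\beta,\gamma}\langle[e^1_\alpha,e^2_\beta],e^3_\gamma\rangle^2$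 with $\{e^i_\alpha\}$ a $\langle\cdot,\cdot\rangle$-orthonormal basis of $\mathfrak{p}_i$. The invariant Riemannian metrics considered are $\mathbf{g}=x_1\langle\cdot,\cdot\rangle|_{\mathfrak{p}_1}+x_2\langle\cdot,\cdot\rangle|_{\mathfrak{p}_2}+x_3\langle\cdot,\cdot\rangle|_{\mathfrak{p}_3}$ with $x_1,x_2,x_3>0$; such a metric is identified with $\mathbf{x}=(x_1,x_2,x_3)\in(0,+\infty)^3$. It is called generic if $x_1,x_2,x_3$ are pairwise distinct. Its Ricci tensor is $\operatorname{Ric}_{\mathbf g}=\sum_{i=1}^3 x_i\mathbf{r}_i\langle\cdot,\cdot\rangle|_{\mathfrak{p}_i}$, where $$\mathbf{r}_i=\frac{1}{2x_i}+\frac{a_i}{2}\left(\frac{x_i}{x_jx_k}-\frac{x_j}{x_kx_i}-\frac{x_k}{x_ix_j}\right),\qquad \{i,j,k\}=\{1,2,3\}.$$ Set $\mathscr{R}_+=\{\mathbf{x}\in(0,+\infty)^3 : \mathbf{r}_1>0,\ \mathbf{r}_2>0,\ \mathbf{r}_3>0\}$; thus $\operatorname{Ric}_{\mathbf g}>0$ is equivalent to $\mathbf{x}\in\mathscr{R}_+$. The normalized Ricci flow $\partial_t\mathbf{g}(t)=-2\operatorname{Ric}_{\mathbf g}+2\mathbf{g}(t)S_{\mathbf g}/n$ ($S_{\mathbf g}$ the scalar curvature, $n=\dim G/H$) on these metrics is the autonomous system on $(0,+\infty)^3$ $$\dot{x}_i=-2x_i\left(\mathbf{r}_i-\frac{a_1^{-1}\mathbf{r}_1+a_2^{-1}\mathbf{r}_2+a_3^{-1}\mathbf{r}_3}{a_1^{-1}+a_2^{-1}+a_3^{-1}}\right),\qquad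 i=1,2,3.$$ *)

theory Defs
  imports "HOL-Analysis.Analysis" "HOL-Library.Function_Algebras"
begin

text \<open>
  The size of the matrices has to vary inside one formula. An n x n real matrix is therefore
  a function \<open>nat \<Rightarrow> nat \<Rightarrow> real\<close> vanishing outside \<open>{..<n} \<times> {..<n}\<close>. On these functions the
  topology is the product topology, which on n x n matrices is the Euclidean one, and addition
  is pointwise. The ring operations \<open>1\<close> and \<open>*\<close> on functions are pointwise as well and are not
  used for matrices.
\<close>

instantiation "fun" :: (type, real_vector) real_vector
begin

definition scaleR_fun :: "real \<Rightarrow> ('a \<Rightarrow> 'b) \<Rightarrow> 'a \<Rightarrow> 'b"
  where "scaleR_fun c f = (\<lambda>x. c *\<^sub>R f x)"

instance
  by standard (auto simp: scaleR_fun_def fun_eq_iff algebra_simps)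

end

type_synonym rmat = "nat \<Rightarrow> nat \<Rightarrow> real"

definition mats :: "nat \<Rightarrow> rmat set"
  where "mats n = {X. \<forall>i j. n \<le> i \<or> n \<le> j \<longrightarrow> X i j = 0}"

definition mat_id :: "nat \<Rightarrow> rmat"
  where "mat_id n = (\<lambda>i j. if i = j \<and> i < n then 1 else 0)"

definition mat_mul :: "nat \<Rightarrow> rmat \<Rightarrow> rmat \<Rightarrow> rmat"
  where "mat_mul n X Y = (\<lambda>i j. \<Sum>k<n. X i k * Y k j)"

definition mat_inverse :: "nat \<Rightarrow> rmat \<Rightarrow> rmat"
  where "mat_inverse n X =
    (THE Y. Y \<in> mats n \<and> mat_mul n X Y = mat_id n \<and> mat_mul n Y X = mat_id n)"

definition mat_group :: "nat \<Rightarrow> rmat set \<Rightarrow> bool"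
  where "mat_group n G \<longleftrightarrow>
    G \<subseteq> mats n \<and> mat_id n \<in> G \<and> (\<forall>X\<in>G. \<forall>Y\<in>G. mat_mul n X Y \<in> G) \<and>
    (\<forall>X\<in>G. \<exists>Y\<in>G. mat_mul n X Y = mat_id n \<and> mat_mul n Y X = mat_id n)"

text \<open>
  Compact Lie groups are taken in their linear realization, as compact subgroups of GL(n,R):
  each such subgroup is a Lie group, and each compact Lie group has a faithful
  finite-dimensional real representation.
\<close>

definition compact_lie_group :: "nat \<Rightarrow> rmat set \<Rightarrow> bool"
  where "compact_lie_group n G \<longleftrightarrow> mat_group n G \<and> compact G"

definition closed_subgroup :: "nat \<Rightarrow> rmat set \<Rightarrow> rmat set \<Rightarrow> bool"
  where "closed_subgroup n H G \<longleftrightarrow> mat_group n H \<and> H \<subseteq> G \<and> closed H"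

text \<open>
  The Lie algebra is the tangent space at the identity, i.e. the set of initial velocities of
  curves in the group. A closed matrix group is an embedded submanifold, so curves that are
  differentiable at 0 yield the same velocities as smooth curves.
\<close>

definition lie_algebra :: "nat \<Rightarrow> rmat set \<Rightarrow> rmat set"
  where "lie_algebra n G =
    {X. \<exists>\<gamma> :: real \<Rightarrow> rmat. (\<forall>t. \<gamma> t \<in> G) \<and> \<gamma> 0 = mat_id n \<and>
        (\<forall>i j. ((\<lambda>t. \<gamma> t i j) has_real_derivative X i j) (at 0))}"

definition bracket :: "nat \<Rightarrow> rmat \<Rightarrow> rmat \<Rightarrow> rmat"
  where "bracket n X Y = mat_mul n X Y - mat_mul n Y X"

definition Ad :: "nat \<Rightarrow> rmat \<Rightarrow> rmat \<Rightarrow> rmat"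
  where "Ad n g X = mat_mul n (mat_mul n g X) (mat_inverse n g)"

definition lie_ideal :: "nat \<Rightarrow> rmat set \<Rightarrow> rmat set \<Rightarrow> bool"
  where "lie_ideal n I \<gg> \<longleftrightarrow>
    subspace I \<and> I \<subseteq> \<gg> \<and> (\<forall>X\<in>\<gg>. \<forall>Y\<in>I. bracket n X Y \<in> I)"

definition semisimple :: "nat \<Rightarrow> rmat set \<Rightarrow> bool"
  where "semisimple n \<gg> \<longleftrightarrow>
    (\<forall>I. lie_ideal n I \<gg> \<and> (\<forall>X\<in>I. \<forall>Y\<in>I. bracket n X Y = 0) \<longrightarrow> I = {0})"

definition trace_on :: "'a::real_vector set \<Rightarrow> ('a \<Rightarrow> 'a) \<Rightarrow> real"
  where "trace_on V f =
    (let B = (SOME B. independent B \<and> span B = V) in \<Sum>b\<in>B. representation B (f b) b)"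

definition killing_form :: "nat \<Rightarrow> rmat set \<Rightarrow> rmat \<Rightarrow> rmat \<Rightarrow> real"
  where "killing_form n \<gg> X Y = trace_on \<gg> (\<lambda>Z. bracket n X (bracket n Y Z))"

definition ip :: "nat \<Rightarrow> rmat set \<Rightarrow> rmat \<Rightarrow> rmat \<Rightarrow> real"
  where "ip n \<gg> X Y = - killing_form n \<gg> X Y"

definition orth_complement :: "nat \<Rightarrow> rmat set \<Rightarrow> rmat set \<Rightarrow> rmat set"
  where "orth_complement n \<gg> \<hh> = {X \<in> \<gg>. \<forall>Y\<in>\<hh>. ip n \<gg> X Y = 0}"

definition orthonormal_basis :: "nat \<Rightarrow> rmat set \<Rightarrow> rmat set \<Rightarrow> rmat set \<Rightarrow> bool"
  where "orthonormal_basis n \<gg> V E \<longleftrightarrow>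
    finite E \<and> span E = V \<and> (\<forall>e\<in>E. \<forall>f\<in>E. ip n \<gg> e f = (if e = f then 1 else 0))"

definition Ad_invariant :: "nat \<Rightarrow> rmat set \<Rightarrow> rmat set \<Rightarrow> bool"
  where "Ad_invariant n H V \<longleftrightarrow> (\<forall>h\<in>H. \<forall>X\<in>V. Ad n h X \<in> V)"

definition irreducible_Ad_module :: "nat \<Rightarrow> rmat set \<Rightarrow> rmat set \<Rightarrow> bool"
  where "irreducible_Ad_module n H V \<longleftrightarrow>
    subspace V \<and> V \<noteq> {0} \<and> Ad_invariant n H V \<and>
    (\<forall>U. subspace U \<and> U \<subseteq> V \<and> Ad_invariant n H U \<longrightarrow> U = {0} \<or> U = V)"

record homogeneous_space =
  msize :: nat
  grp :: "rmat set"
  isot :: "rmat set"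
  modl :: "3 \<Rightarrow> rmat set"

abbreviation Lie_G :: "homogeneous_space \<Rightarrow> rmat set"
  where "Lie_G W \<equiv> lie_algebra (msize W) (grp W)"

abbreviation Lie_H :: "homogeneous_space \<Rightarrow> rmat set"
  where "Lie_H W \<equiv> lie_algebra (msize W) (isot W)"

text \<open>
  The order of the three modules matters only for the numbering of the parameters. The
  last-but-one conjunct of the definition below says that the complement is the sum of the
  modules; the sum is direct because the modules are pairwise orthogonal for the inner product
  \<open>ip\<close>. The last conjunct is the usual convention that G/H is almost effective. Without it
  one could replace \<open>(G, H)\<close> by \<open>(G \<times> K, H \<times> K)\<close> and so obtain infinitely many pairs of Lie
  algebras from a single space.
\<close>

definition generalized_wallach_space :: "homogeneous_space \<Rightarrow> bool"
  where "generalized_wallach_space W \<longleftrightarrow>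
    (let n = msize W; G = grp W; H = isot W; \<pp> = modl W;
         \<gg> = lie_algebra n G; \<hh> = lie_algebra n H
     in compact_lie_group n G \<and> semisimple n \<gg> \<and> closed_subgroup n H G \<and>
        (\<forall>i. irreducible_Ad_module n H (\<pp> i)) \<and>
        (\<forall>i. \<forall>X\<in>\<pp> i. \<forall>Y\<in>\<pp> i. bracket n X Y \<in> \<hh>) \<and>
        (\<forall>i j. i \<noteq> j \<longrightarrow> (\<forall>X\<in>\<pp> i. \<forall>Y\<in>\<pp> j. ip n \<gg> X Y = 0)) \<and>
        orth_complement n \<gg> \<hh> = {X 1 + X 2 + X 3 | X. \<forall>i. X i \<in> \<pp> i} \<and>
        (\<forall>I. lie_ideal n I \<gg> \<and> I \<subseteq> \<hh> \<longrightarrow> I = {0}))"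

text \<open>
  The number A below does not depend on the orthonormal bases. Membership of the parameters
  in (0,1/2] excludes A = 0, i.e. the (local) products of three irreducible symmetric spaces,
  for which the Ricci flow system would contain the undefined quantities \<open>1 / a $ i\<close>.
\<close>

definition gws_parameters :: "homogeneous_space \<Rightarrow> real^3 \<Rightarrow> bool"
  where "gws_parameters W a \<longleftrightarrow>
    (\<exists>E :: 3 \<Rightarrow> rmat set.
       (\<forall>i. orthonormal_basis (msize W) (Lie_G W) (modl W i) (E i)) \<and>
       (let A = (\<Sum>e1\<in>E 1. \<Sum>e2\<in>E 2. \<Sum>e3\<in>E 3.
                   (ip (msize W) (Lie_G W) (bracket (msize W) e1 e2) e3)\<^sup>2)
        in \<forall>i. a $ i = A / real (dim (modl W i)))) \<and>
    (\<forall>i. 0 < a $ i \<and> a $ i \<le> 1/2)"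

definition pair_isomorphic :: "homogeneous_space \<Rightarrow> homogeneous_space \<Rightarrow> bool"
  where "pair_isomorphic W W' \<longleftrightarrow>
    (\<exists>\<phi>. linear \<phi> \<and> bij_betw \<phi> (Lie_G W) (Lie_G W') \<and> \<phi> ` Lie_H W = Lie_H W' \<and>
         (\<forall>X\<in>Lie_G W. \<forall>Y\<in>Lie_G W.
            \<phi> (bracket (msize W) X Y) = bracket (msize W') (\<phi> X) (\<phi> Y)))"

text \<open>
  Arithmetic in the index type \<open>3\<close> is modulo 3, so \<open>{i, i + 1, i + 2}\<close> are the three indices.
\<close>

definition ricci :: "real^3 \<Rightarrow> real^3 \<Rightarrow> 3 \<Rightarrow> real"
  where "ricci a x i =
    (let j = i + 1; k = i + 2
     in 1 / (2 * x $ i) +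
        a $ i / 2 * (x $ i / (x $ j * x $ k) - x $ j / (x $ k * x $ i) - x $ k / (x $ i * x $ j)))"

definition ricci_positive :: "real^3 \<Rightarrow> (real^3) set"
  where "ricci_positive a = {x. (\<forall>i. 0 < x $ i) \<and> (\<forall>i. 0 < ricci a x i)}"

definition nrf_field :: "real^3 \<Rightarrow> real^3 \<Rightarrow> real^3"
  where "nrf_field a x =
    (\<chi> i. - 2 * x $ i *
       (ricci a x i - (\<Sum>j\<in>UNIV. 1 / a $ j * ricci a x j) / (\<Sum>j\<in>UNIV. 1 / a $ j)))"

definition nrf_solution :: "real^3 \<Rightarrow> real^3 \<Rightarrow> ereal \<Rightarrow> (real \<Rightarrow> real^3) \<Rightarrow> bool"
  where "nrf_solution a x0 T x \<longleftrightarrow>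
    0 < T \<and> x 0 = x0 \<and>
    (\<forall>t. 0 \<le> t \<and> ereal t < T \<longrightarrow>
       (\<forall>i. 0 < x t $ i) \<and>
       (x has_vector_derivative nrf_field a (x t)) (at t within {s. 0 \<le> s \<and> ereal s < T}))"

definition maximal_nrf_solution :: "real^3 \<Rightarrow> real^3 \<Rightarrow> ereal \<Rightarrow> (real \<Rightarrow> real^3) \<Rightarrow> bool"
  where "maximal_nrf_solution a x0 T x \<longleftrightarrow>
    nrf_solution a x0 T x \<and>
    \<not> (\<exists>T' y. T < T' \<and> nrf_solution a x0 T' y \<and>
              (\<forall>t. 0 \<le> t \<and> ereal t < T \<longrightarrow> y t = x t))"

definition generic :: "real^3 \<Rightarrow> bool"
  where "generic x \<longleftrightarrow> x $ 1 \<noteq> x $ 2 \<and> x $ 1 \<noteq> x $ 3 \<and> x $ 2 \<noteq> x $ 3"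

end

(*
  The spaces are O(k+2)/O(k) with k > 1, where O(k) fixes the last two coordinates. The modules
  are the plane rotation generator in these two coordinates and the two copies of R^k that pair
  R^k with one of them; the parameters are (1/2, 1/(2k), 1/(2k)).

  Let P_i = 2 x_1 x_2 x_3 r_i, a polynomial with the sign of r_i. At a first time at which some
  P_i vanishes all P_j are nonnegative, and then elementary algebra gives a strictly positive
  time derivative of P_i, a contradiction. The normalization of the flow does not matter, as it
  only adds a multiple of P_i to this derivative.

  On the Lie side everything is computed with wedges u v^T - v u^T: Householder reflections
  yield both the one-parameter velocities that span the Lie algebra and the irreducibility of
  R^k, and the Killing form comes out as -(n-2) times the Euclidean inner product of entries.
*)

theory Submission
  imports Defs
begin

subsection \<open>The Ricci flow for the parameters (1/2, 1/(2k), 1/(2k))\<close>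

text \<open>Where P_i = 0, the derivative of P_i is, up to the factor 1/(x_1 x_2 x_3), equal to x_j
  (2 a_i x_j - x_k) P_j + x_k (2 a_i x_k - x_j) P_k. On the relevant part of the surface P_i = 0 the
  two coefficients have opposite signs, so nonnegativity of P_j and P_k does not settle the sign and
  the equation of the surface has to enter. The parameters make this tractable: with a_1 = 1/2 the
  surface P_1 = 0 degenerates to the planes x_1 = |x_2 - x_3|, and with a_2 = a_3 a reflection
  exchanges the other two surfaces. On Lie algebras the family is the case l = m = 1 of
  SO(k+l+m)/(SO(k) SO(l) SO(m)), whose parameters are k, l, m divided by 2 (k+l+m-2); hence a_1 =
  1/2. Full orthogonal groups are taken because a single reflection then lies in the isotropy group,
  and irreducibility follows from reflecting one vector.\<close>

lemma positive_until_exit: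
  fixes f :: "'i::finite \<Rightarrow> real \<Rightarrow> real"
  assumes cont: "\<And>i. continuous_on {0..t} (f i)"
    and init: "\<And>i. 0 < f i 0"
    and inward: "\<And>i s. 0 < s \<Longrightarrow> s \<le> t \<Longrightarrow> (\<And>j. 0 \<le> f j s) \<Longrightarrow> f i s = 0 \<Longrightarrow>
      \<exists>d>0. (f i has_real_derivative d) (at s within {0..t})"
    and "0 \<le> t"
  shows "0 < f i t"
proof (rule ccontr)
  assume neg: "\<not> 0 < f i t"
  define S where "S = (\<Union>j. {s \<in> {0..t}. f j s \<le> 0})"
  have "closed {s \<in> {0..t}. f j s \<le> 0}" for j
    by (intro continuous_on_closed_Collect_le cont continuous_intros closed_atLeastAtMost)
  then have "closed S" unfolding S_def by (intro closed_UN) auto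
  have "t \<in> S" using neg \<open>0 \<le> t\<close> by (auto simp: S_def intro!: exI[of _ i])
  have bdd: "bdd_below S" by (rule bdd_belowI[of _ 0]) (auto simp: S_def)
  define s where "s = Inf S"
  have "s \<in> S" unfolding s_def using closed_contains_Inf \<open>closed S\<close> bdd \<open>t \<in> S\<close> by blast
  then obtain j where j: "f j s \<le> 0" and s: "0 \<le> s" "s \<le> t" by (auto simp: S_def)
  then have "0 < s" using init[of j] by (cases "s = 0") auto
  have before: "0 < f m r" if "0 \<le> r" "r < s" for m r
  proof (rule ccontr)
    assume "\<not> 0 < f m r"
    then have "r \<in> S" using that s by (auto simp: S_def intro!: exI[of _ m])
    then have "s \<le> r" unfolding s_def by (rule cInf_lower) (rule bdd)
    then show False using that by simp
  qed
  have nonneg: "0 \<le> f m s" for m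
  proof (rule tendsto_lowerbound)
    show "(f m \<longlongrightarrow> f m s) (at s within {0<..<s})"
      by (rule tendsto_within_subset[where S = "{0..t}"])
        (use cont[of m] s in \<open>auto simp: continuous_on_def\<close>)
    show "eventually (\<lambda>r. 0 \<le> f m r) (at s within {0<..<s})"
      by (auto simp: eventually_at_filter intro!: always_eventually less_imp_le before)
    show "at s within {0<..<s} \<noteq> bot"
      using \<open>0 < s\<close> by (simp add: trivial_limit_within islimpt_greaterThanLessThan2)
  qed
  then have "f j s = 0" using j by (simp add: antisym)
  then obtain d where "0 < d" "(f j has_real_derivative d) (at s within {0..t})"
    using inward[of s j] nonneg \<open>0 < s\<close> s by blast
  then obtain e where "0 < e" and e: "\<And>h. 0 < h \<Longrightarrow> s - h \<in> {0..t} \<Longrightarrow> h < e \<Longrightarrow> f j (s - h) < f j s"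
    using has_real_derivative_pos_inc_left by metis
  \<comment> \<open>The cap at \<open>s\<close> keeps \<open>s - h\<close> in the interval from 0 to
    \<open>s\<close>; the value 0 may occur and is covered by \<open>before\<close>.\<close>
  define h where "h = min (e / 2) s"
  have "f j (s - h) < f j s" by (rule e) (use \<open>0 < e\<close> \<open>0 < s\<close> s in \<open>auto simp: h_def\<close>)
  moreover have "0 < f j (s - h)" by (rule before) (use \<open>0 < e\<close> \<open>0 < s\<close> s in \<open>auto simp: h_def\<close>)
  ultimately show False using \<open>f j s = 0\<close> by simp
qed

text \<open>A quadratic form, so the pieces of the boundary are cones. \<open>x\<close> is the
  coordinate carrying the same index as \<open>a\<close>; the other two enter symmetrically.\<close>

definition ricci_num :: "real \<Rightarrow> real \<Rightarrow> real \<Rightarrow> real \<Rightarrow> real"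
  where "ricci_num a x y z = y * z + a * (x\<^sup>2 - y\<^sup>2 - z\<^sup>2)"

text \<open>On the zero set x = |y - z|, and substituting this collapses the second factor to 4 a y
  z (y - z). The product is then a positive multiple of (y - z)^2, which equals x^2 and so is
  positive.\<close>

lemma inward_half:
  assumes "0 < x" "0 < y" "0 < z" "0 < a" and zero: "ricci_num (1/2) x y z = 0"
  shows "0 < (y - z) * (y * ricci_num a y z x - z * ricci_num a z x y)"
proof -
  have sq: "x\<^sup>2 = (y - z)\<^sup>2"
    using zero by (simp add: ricci_num_def power2_eq_square algebra_simps)
  have gap: "y * ricci_num a y z x - z * ricci_num a z x y = 4 * a * y * z * (y - z)"
    unfolding ricci_num_def sq by (simp add: power2_eq_square algebra_simps)
  have "0 < (y - z)\<^sup>2" using sq \<open>0 < x\<close> by (metis zero_less_power)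
  then have "0 < 4 * a * y * z * (y - z)\<^sup>2" using assms by simp
  then show ?thesis unfolding gap by (simp add: power2_eq_square algebra_simps)
qed

text \<open>The cone y^2 = x^2 + z^2 - 2 k x z has two sheets, one in x > k z and one in z > k x. On
  the second sheet P_1 is negative, so \<open>nonneg\<close> selects the first. There x / k - z is
  positive and z / k - x is negative, and the first summand has to outweigh the second.\<close>

lemma inward_small:
  assumes pos: "0 < x" "0 < y" "0 < z" and k: "1 < (k::real)"
    and zero: "ricci_num (1 / (2 * k)) y z x = 0"
    and nonneg: "0 \<le> ricci_num (1/2) x y z"
  shows "0 < x * ricci_num (1/2) x y z * (x / k - z)
           + z * ricci_num (1 / (2 * k)) z x y * (z / k - x)"
proof -
  have sq: "y\<^sup>2 = x\<^sup>2 + z\<^sup>2 - 2 * k * x * z"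
    using zero k by (simp add: ricci_num_def divide_simps) (simp add: algebra_simps)
  have P1: "ricci_num (1/2) x y z = z * (k * x - z + y)"
    unfolding ricci_num_def sq by (simp add: power2_eq_square algebra_simps)
  have P3: "ricci_num (1 / (2 * k)) z x y = x * (y + z - x / k)"
    unfolding ricci_num_def sq using k by (simp add: power2_eq_square field_simps)
  have "k\<^sup>2 > 1" using k by (simp add: one_less_power)
  have sq': "(x - k * z)\<^sup>2 = y\<^sup>2 + (k\<^sup>2 - 1) * z\<^sup>2"
    unfolding sq by (simp add: power2_eq_square algebra_simps)
  have far: "y\<^sup>2 < (x - k * z)\<^sup>2" unfolding sq' using \<open>k\<^sup>2 > 1\<close> pos by simp
  \<comment> \<open>If k x \<le> z, then P_1 \<ge> 0 forces z - k x \<le> y, although y^2 < (z - k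
    x)^2 on the cone. Between the sheets, where x \<le> k z and z < k x, the equation of the cone
    would give y^2 \<le> 0.\<close>
  have "k * z < x"
  proof (rule ccontr)
    assume "\<not> k * z < x"
    show False
    proof (cases "k * x \<le> z")
      case True
      then have "z - k * x \<le> y" using nonneg pos by (simp add: P1 zero_le_mult_iff)
      then have "(z - k * x)\<^sup>2 \<le> y\<^sup>2" using True by (intro power_mono) auto
      then have "(k\<^sup>2 - 1) * x\<^sup>2 \<le> 0" unfolding sq by (simp add: power2_eq_square algebra_simps)
      then show False using \<open>k\<^sup>2 > 1\<close> pos by (simp add: mult_le_0_iff)
    next
      case False
      have "x * x \<le> k * z * x" using \<open>\<not> k * z < x\<close> pos by (intro mult_right_mono) auto
      moreover have "z * z \<le> k * x * z" using False pos by (intro mult_right_mono) auto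
      ultimately have "y\<^sup>2 \<le> 0" unfolding sq by (simp add: power2_eq_square algebra_simps)
      then show False using pos by simp
    qed
  qed
  then have "y < x - k * z" using far by (simp add: power2_less_imp_less)
  have "z < x / k" using \<open>k * z < x\<close> k by (simp add: field_simps)
  have "z < k * x"
  proof -
    have "z < k * z" using k pos by simp
    also note \<open>k * z < x\<close>
    also have "x < k * x" using k pos by simp
    finally show ?thesis .
  qed
  \<comment> \<open>This is what remains of the claim after inserting \<open>P1\<close> and
    \<open>P3\<close> and dividing by x z / k. The terms are grouped so that every factor is
    positive on the selected sheet.\<close>
  have "0 < (k * x - z) * ((x - k * z - y) + (x / k - z)) + y * (x - k * z)"
    using \<open>z < k * x\<close> \<open>y < x - k * z\<close> \<open>z < x / k\<close> \<open>k * z < x\<close> pos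
    by (intro add_pos_pos mult_pos_pos) auto
  moreover have "x * ricci_num (1/2) x y z * (x / k - z)
           + z * ricci_num (1 / (2 * k)) z x y * (z / k - x)
    = x * z / k * ((k * x - z) * ((x - k * z - y) + (x / k - z)) + y * (x - k * z))"
    unfolding P1 P3 using k by (simp add: field_simps)
  ultimately show ?thesis using pos k by simp
qed

definition wallach_params :: "nat \<Rightarrow> real^3"
  where "wallach_params k = (\<chi> i. if i = 1 then 1 / 2 else 1 / (2 * real k))"

lemma ricci_num_commute: "ricci_num a x y z = ricci_num a x z y"
  by (simp add: ricci_num_def)

lemma numerals_mod_3: "(4::3) = 1" "(5::3) = 2"
  by simp_all

lemma ricci_eq_ricci_num:
  assumes "\<And>i. 0 < x $ i"
  shows "ricci a x i =
    ricci_num (a $ i) (x $ i) (x $ (i+1)) (x $ (i+2)) / (2 * (x $ 1 * x $ 2 * x $ 3))"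
proof -
  have nz: "x $ j \<noteq> 0" for j using assms[of j] by simp
  show ?thesis
    using exhaust_3[of i] nz[of 1] nz[of 2] nz[of 3]
    by (auto simp: ricci_def ricci_num_def Let_def numerals_mod_3 field_simps power2_eq_square)
qed

text \<open>Each coordinate moves by a common scaling at rate \<open>c\<close> and an individual
  term. By Euler's identity for a form of degree 2 the scaling contributes 2 c times the form, which
  vanishes at a zero; the individual terms give the stated value.\<close>

lemma ricci_num_has_derivative:
  assumes "(x has_real_derivative c * x s - x s * p / D) (at s within S)"
    and "(y has_real_derivative c * y s - y s * q / D) (at s within S)"
    and "(z has_real_derivative c * z s - z s * r / D) (at s within S)"
    and zero: "ricci_num a (x s) (y s) (z s) = 0"
  shows "((\<lambda>t. ricci_num a (x t) (y t) (z t)) has_real_derivative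
    (2 * a * ((y s)\<^sup>2 * q + (z s)\<^sup>2 * r - (x s)\<^sup>2 * p) - y s * z s * (q + r)) / D) (at s within S)"
proof -
  have "((\<lambda>t. ricci_num a (x t) (y t) (z t)) has_real_derivative
    2 * c * ricci_num a (x s) (y s) (z s) +
    (2 * a * ((y s)\<^sup>2 * q + (z s)\<^sup>2 * r - (x s)\<^sup>2 * p) - y s * z s * (q + r)) / D) (at s within S)"
    unfolding ricci_num_def
    by (rule derivative_eq_intros assms(1-3) refl)+
      (simp add: algebra_simps power2_eq_square diff_divide_distrib add_divide_distrib)
  then show ?thesis by (simp add: zero)
qed

lemma ricci_positive_preserved:
  assumes k: "1 < k"
    and x0: "x0 \<in> ricci_positive (wallach_params k)"
    and sol: "nrf_solution (wallach_params k) x0 T x"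
    and t: "0 < t" "ereal t < T"
  shows "x t \<in> ricci_positive (wallach_params k)"
proof -
  let ?a = "wallach_params k"
  define N where "N i s = ricci_num (?a $ i) (x s $ i) (x s $ (i+1)) (x s $ (i+2))" for i s
  define D where "D s = x s $ 1 * x s $ 2 * x s $ 3" for s
  \<comment> \<open>Twice the weighted mean of the Ricci coefficients, that is, the rate at which
    the normalization rescales all three coordinates alike.\<close>
  define c where "c s = 2 * ((\<Sum>j\<in>UNIV. 1 / ?a $ j * ricci ?a (x s) j) / (\<Sum>j\<in>UNIV. 1 / ?a $ j))" for s
  have pos: "0 < x s $ i" if "0 \<le> s" "s \<le> t" for s i
    using sol that t by (auto simp: nrf_solution_def le_less_trans[of "ereal s" "ereal t"])
  have D: "0 < D s" if "0 \<le> s" "s \<le> t" for s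
    using pos[OF that] by (simp add: D_def)
  have ricci_N: "ricci ?a (x s) i = N i s / (2 * D s)" if "0 \<le> s" "s \<le> t" for s i
    unfolding N_def D_def by (rule ricci_eq_ricci_num) (rule pos[OF that])
  have der: "((\<lambda>s. x s $ i) has_real_derivative c s * x s $ i - x s $ i * N i s / D s) (at s within {0..t})"
    if s: "0 \<le> s" "s \<le> t" for s i
  proof -
    have "ereal s < T" using s t by (simp add: le_less_trans[of "ereal s" "ereal t"])
    then have "(x has_vector_derivative nrf_field ?a (x s)) (at s within {s. 0 \<le> s \<and> ereal s < T})"
      using sol s by (simp add: nrf_solution_def)
    then have "(x has_vector_derivative nrf_field ?a (x s)) (at s within {0..t})"
      by (rule has_vector_derivative_within_subset)
        (use t in \<open>auto simp: le_less_trans[of _ "ereal t"]\<close>)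
    from bounded_linear.has_vector_derivative[OF bounded_linear_vec_nth this, of i]
    have "((\<lambda>s. x s $ i) has_real_derivative nrf_field ?a (x s) $ i) (at s within {0..t})"
      by (simp add: has_real_derivative_iff_has_vector_derivative)
    moreover have "nrf_field ?a (x s) $ i = c s * x s $ i - x s $ i * N i s / D s"
      using D[OF s] by (simp add: nrf_field_def c_def[symmetric] ricci_N[OF s, of i] field_simps)
        (simp add: c_def)
    ultimately show ?thesis by simp
  qed
  have init: "0 < N i 0" for i
  proof -
    have "0 < ricci ?a (x 0) i" using x0 sol by (simp add: nrf_solution_def ricci_positive_def)
    then show ?thesis using D[of 0] t by (simp add: ricci_N zero_less_divide_iff)
  qed
  have cont: "continuous_on {0..t} (N i)" for i
  proof -
    have x: "continuous_on {0..t} (\<lambda>s. x s $ j)" for j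
      by (rule DERIV_continuous_on[OF der]) auto
    show ?thesis unfolding N_def ricci_num_def by (intro x continuous_intros)
  qed
  have inward: "\<exists>d>0. (N i has_real_derivative d) (at s within {0..t})"
    if s: "0 < s" "s \<le> t" and nonneg: "\<And>j. 0 \<le> N j s" and zero: "N i s = 0" for i s
  proof -
    let ?d = "(2 * ?a $ i * ((x s $ (i+1))\<^sup>2 * N (i+1) s + (x s $ (i+2))\<^sup>2 * N (i+2) s - (x s $ i)\<^sup>2 * N i s)
      - x s $ (i+1) * x s $ (i+2) * (N (i+1) s + N (i+2) s)) / D s"
    have s': "0 \<le> s" "s \<le> t" using s by auto
    have "(N i has_real_derivative ?d) (at s within {0..t})"
      using ricci_num_has_derivative[OF der[OF s', of i] der[OF s', of "i+1"] der[OF s', of "i+2"],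
          of "?a $ i"] zero
      unfolding N_def by simp
    moreover have "0 < ?d"
    proof (rule divide_pos_pos)
      show "0 < D s" by (rule D[OF s'])
      have p: "0 < x s $ 1" "0 < x s $ 2" "0 < x s $ 3" using pos[OF s'] by auto
      let ?X = "x s $ 1" and ?Y = "x s $ 2" and ?Z = "x s $ 3" and ?e = "1 / (2 * real k)"
      have N1: "N 1 s = ricci_num (1/2) ?X ?Y ?Z"
        and N2: "N 2 s = ricci_num ?e ?Y ?Z ?X"
        and N3: "N 3 s = ricci_num ?e ?Z ?X ?Y"
        by (simp_all add: N_def wallach_params_def numerals_mod_3)
      have k': "1 < real k" using k by simp
      consider "i = 1" | "i = 2" | "i = 3" using exhaust_3[of i] by auto
      then show "0 < 2 * ?a $ i * ((x s $ (i+1))\<^sup>2 * N (i+1) s + (x s $ (i+2))\<^sup>2 * N (i+2) s - (x s $ i)\<^sup>2 * N i s)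
        - x s $ (i+1) * x s $ (i+2) * (N (i+1) s + N (i+2) s)"
      proof cases
        case 1
        \<comment> \<open>Because 2 a_1 = 1, the numerator of the derivative factors into this
          product.\<close>
        have "0 < (?Y - ?Z) * (?Y * N 2 s - ?Z * N 3 s)"
          unfolding N2 N3 by (rule inward_half) (use p k zero 1 N1 in auto)
        also have "\<dots> = ?Y\<^sup>2 * N 2 s + ?Z\<^sup>2 * N 3 s - ?Y * ?Z * (N 2 s + N 3 s)"
          by (simp add: power2_eq_square algebra_simps)
        finally show ?thesis using zero 1 by (simp add: wallach_params_def numerals_mod_3)
      next
        case 2
        have "0 < ?X * N 1 s * (?X / k - ?Z) + ?Z * N 3 s * (?Z / k - ?X)"
          unfolding N1 N3 by (rule inward_small) (use p k' zero 2 N1 N2 nonneg[of 1] in auto)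
        also have "\<dots> = 2 * ?e * (?Z\<^sup>2 * N 3 s + ?X\<^sup>2 * N 1 s) - ?Z * ?X * (N 3 s + N 1 s)"
          using k by (simp add: power2_eq_square field_simps)
        finally show ?thesis using zero 2 by (simp add: wallach_params_def numerals_mod_3)
      next
        case 3
        \<comment> \<open>Since a_2 = a_3, exchanging the second and third coordinates turns this
          case into the preceding one; the symmetry of \<open>ricci_num\<close> in its last two
          arguments supplies the rewriting.\<close>
        have "0 < ?X * N 1 s * (?X / k - ?Y) + ?Y * N 2 s * (?Y / k - ?X)"
          unfolding N1 N2 ricci_num_commute[of _ ?X ?Y ?Z] ricci_num_commute[of _ ?Y ?Z ?X]
          by (rule inward_small)
            (use p k' zero 3 N1 N3 nonneg[of 1] in \<open>auto simp: ricci_num_commute\<close>)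
        also have "\<dots> = 2 * ?e * (?X\<^sup>2 * N 1 s + ?Y\<^sup>2 * N 2 s) - ?X * ?Y * (N 1 s + N 2 s)"
          using k by (simp add: power2_eq_square field_simps)
        finally show ?thesis using zero 3 by (simp add: wallach_params_def numerals_mod_3)
      qed
    qed
    ultimately show ?thesis by blast
  qed
  have "0 < N i t" for i
    by (rule positive_until_exit[OF cont init inward]) (use t in auto)
  then show ?thesis
    using pos[of t] D[of t] t by (simp add: ricci_positive_def ricci_N)
qed

subsection \<open>Orthogonal groups and their Lie algebras\<close>

lemma scaleR_fun_apply [simp]: "(c *\<^sub>R f) x = c *\<^sub>R f x"
  by (simp add: scaleR_fun_def)

lemma sum_fun_apply: "(\<Sum>i\<in>I. f i) x = (\<Sum>i\<in>I. f i x)"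
  by (induction I rule: infinite_finite_induct) simp_all

lemma linear_scaled_entry: "linear (\<lambda>X :: rmat. c * X i j)"
  by (intro linearI) (simp_all add: algebra_simps)

section \<open>Traces and linear independence from coordinate functionals\<close>

text \<open>The chosen basis in \<open>trace_on\<close> is opaque, so the trace is moved to an
  explicit family by expanding each basis vector and swapping the two sums, as in tr(AB) = tr(BA).
  The family may be redundant: it only has to reproduce every vector of \<open>V\<close>. This
  permits the sum over all ordered pairs of indices below.\<close>

lemma trace_on_coordinates:
  fixes f :: "'a::real_vector \<Rightarrow> 'a"
  assumes "subspace V" "finite I" "\<And>i. i \<in> I \<Longrightarrow> e i \<in> V" "\<And>i. linear (c i)"
    and expand: "\<And>v. v \<in> V \<Longrightarrow> v = (\<Sum>i\<in>I. c i v *\<^sub>R e i)"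
    and f: "linear f" "f ` V \<subseteq> V"
  shows "trace_on V f = (\<Sum>i\<in>I. c i (f (e i)))"
proof -
  define B where "B = (SOME B. independent B \<and> span B = V)"
  have "\<exists>B. independent B \<and> span B = V"
    using basis_exists[of V] span_subspace[OF _ _ \<open>subspace V\<close>] by metis
  then have B: "independent B" "span B = V"
    unfolding B_def by (metis (mono_tags, lifting) someI_ex)+
  have "V \<subseteq> span (e ` I)"
  proof
    fix v assume "v \<in> V"
    from expand[OF this] show "v \<in> span (e ` I)"
      by (metis (no_types, lifting) imageI span_base span_scale span_sum)
  qed
  then have "finite B"
    using B \<open>finite I\<close> by (metis finite_imageI independent_span_bound span_superset subset_trans)
  have fe: "f (e i) \<in> span B" if "i \<in> I" for i using assms B that by blast
  have *: "representation B (f b) b = (\<Sum>i\<in>I. c i b * representation B (f (e i)) b)" if "b \<in> B" for b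
  proof -
    have "b \<in> V" using that B span_base by blast
    then have "f b = f (\<Sum>i\<in>I. c i b *\<^sub>R e i)" using expand by simp
    also have "\<dots> = (\<Sum>i\<in>I. c i b *\<^sub>R f (e i))" using f(1) by (simp add: linear_sum linear_scale)
    finally have "f b = (\<Sum>i\<in>I. c i b *\<^sub>R f (e i))" .
    moreover have "representation B (\<Sum>i\<in>I. c i b *\<^sub>R f (e i)) b =
        (\<Sum>i\<in>I. representation B (c i b *\<^sub>R f (e i)) b)"
      by (rule real_vector.representation_sum[THEN fun_cong, of B I, simplified])
        (use B fe in \<open>auto intro: span_scale\<close>)
    ultimately show ?thesis
      using B fe by (simp add: representation_scale)
  qed
  have "trace_on V f = (\<Sum>b\<in>B. representation B (f b) b)"
    by (simp add: trace_on_def B_def Let_def)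
  also have "\<dots> = (\<Sum>i\<in>I. \<Sum>b\<in>B. representation B (f (e i)) b * c i b)"
    by (subst sum.swap) (simp add: * mult.commute cong: sum.cong)
  also have "\<dots> = (\<Sum>i\<in>I. c i (\<Sum>b\<in>B. representation B (f (e i)) b *\<^sub>R b))"
    using assms(4) by (simp add: linear_sum linear_scale)
  also have "\<dots> = (\<Sum>i\<in>I. c i (f (e i)))"
    using B fe \<open>finite B\<close> by (simp add: sum_representation_eq cong: sum.cong)
  finally show ?thesis .
qed

text \<open>Applying \<open>c i\<close> to a linear relation isolates the coefficient of
  \<open>e i\<close>. Injectivity comes along because the sizes of these bases are counted through
  their index sets.\<close>

lemma dual_family_independent:
  fixes e :: "'i \<Rightarrow> 'a::real_vector" and c :: "'i \<Rightarrow> 'a \<Rightarrow> real"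
  assumes "finite I" "\<And>i. linear (c i)"
    and dual: "\<And>i j. i \<in> I \<Longrightarrow> j \<in> I \<Longrightarrow> c i (e j) = (if i = j then 1 else 0)"
  shows "inj_on e I" "independent (e ` I)"
proof -
  show inj: "inj_on e I"
    by (intro inj_onI) (metis dual zero_neq_one)
  show "independent (e ` I)"
  proof (rule independent_if_scalars_zero)
    fix u x assume 0: "(\<Sum>v\<in>e ` I. u v *\<^sub>R v) = 0" and "x \<in> e ` I"
    then obtain i where i: "i \<in> I" "x = e i" by blast
    have "0 = c i (\<Sum>j\<in>I. u (e j) *\<^sub>R e j)"
      using 0 assms(2) by (simp add: sum.reindex[OF inj] linear_0)
    also have "\<dots> = (\<Sum>j\<in>I. u (e j) * (if i = j then 1 else 0))"
      using assms(2) i dual by (simp add: linear_sum linear_scale cong: sum.cong)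
    also have "\<dots> = (\<Sum>j\<in>I. if i = j then u (e j) else 0)"
      by (intro sum.cong) auto
    also have "\<dots> = u x" using i \<open>finite I\<close> by simp
    finally show "u x = 0" by simp
  qed (use assms in auto)
qed

section \<open>Wedges, orthogonal matrices and skew matrices\<close>

definition unit :: "nat \<Rightarrow> nat \<Rightarrow> real"
  where "unit i p = (if p = i then 1 else 0)"

definition vecs :: "nat \<Rightarrow> (nat \<Rightarrow> real) set"
  where "vecs m = {v. \<forall>p\<ge>m. v p = 0}"

definition dot :: "nat \<Rightarrow> (nat \<Rightarrow> real) \<Rightarrow> (nat \<Rightarrow> real) \<Rightarrow> real"
  where "dot n u v = (\<Sum>p<n. u p * v p)"

definition mat_vec :: "nat \<Rightarrow> rmat \<Rightarrow> (nat \<Rightarrow> real) \<Rightarrow> nat \<Rightarrow> real"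
  where "mat_vec n X v = (\<lambda>i. \<Sum>p<n. X i p * v p)"

definition wedge :: "(nat \<Rightarrow> real) \<Rightarrow> (nat \<Rightarrow> real) \<Rightarrow> rmat"
  where "wedge u v = (\<lambda>p q. u p * v q - v p * u q)"

abbreviation (input) mat_transpose :: "rmat \<Rightarrow> rmat"
  where "mat_transpose X \<equiv> \<lambda>i j. X j i"

text \<open>O(m) as the upper left block of n x n matrices. Agreement with \<open>mat_id n\<close>
  outside the block means 1 on the diagonal positions from m to n - 1 and 0 elsewhere, so one
  definition serves the group (m = n) and the isotropy group (m = k). Both products are prescribed,
  so the transpose is a two-sided inverse at once.\<close>

definition orth :: "nat \<Rightarrow> nat \<Rightarrow> rmat set"
  where "orth n m = {X. (\<forall>i j. m \<le> i \<or> m \<le> j \<longrightarrow> X i j = mat_id n i j) \<and>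
    mat_mul n X (mat_transpose X) = mat_id n \<and> mat_mul n (mat_transpose X) X = mat_id n}"

definition skew :: "nat \<Rightarrow> rmat set"
  where "skew m = {X \<in> mats m. \<forall>i j. X i j + X j i = 0}"

lemma skewI: "X \<in> mats m \<Longrightarrow> (\<And>i j. X j i = - X i j) \<Longrightarrow> X \<in> skew m"
  by (auto simp: skew_def eq_neg_iff_add_eq_0 add.commute)

lemma skew_swap: "X \<in> skew m \<Longrightarrow> X j i = - X i j"
  by (simp add: skew_def eq_neg_iff_add_eq_0)

lemma skew_outside: "X \<in> skew m \<Longrightarrow> m \<le> i \<or> m \<le> j \<Longrightarrow> X i j = 0"
  by (auto simp: skew_def mats_def)

lemma skew_diagonal: "X \<in> skew m \<Longrightarrow> X i i = 0"
  using skew_swap[of X m i i] by simp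

lemma skew_subset_mats: "m \<le> n \<Longrightarrow> skew m \<subseteq> mats n"
  by (auto simp: skew_def mats_def)

lemma sum_unit [simp]:
  "(\<Sum>p<n. unit i p * f p) = (if i < n then f i else 0)"
  "(\<Sum>p<n. f p * unit i p) = (if i < n then f i else 0)"
proof -
  have "(\<Sum>p<n. unit i p * f p) = (\<Sum>p<n. if p = i then f p else 0)"
    by (rule sum.cong) (auto simp: unit_def)
  then show "(\<Sum>p<n. unit i p * f p) = (if i < n then f i else 0)" by simp
  then show "(\<Sum>p<n. f p * unit i p) = (if i < n then f i else 0)" by (simp add: mult.commute)
qed

lemma mat_id_unit: "i < n \<Longrightarrow> mat_id n i j = unit i j" "j < n \<Longrightarrow> mat_id n i j = unit j i"
  by (auto simp: mat_id_def unit_def)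

lemma mat_id_outside: "n \<le> i \<Longrightarrow> mat_id n i j = 0" "n \<le> j \<Longrightarrow> mat_id n i j = 0"
  by (auto simp: mat_id_def)

lemma mat_id_commute: "mat_id n i j = mat_id n j i"
  by (auto simp: mat_id_def)

lemma mat_mul_assoc: "mat_mul n (mat_mul n X Y) Z = mat_mul n X (mat_mul n Y Z)"
proof (intro ext)
  fix i j
  have "(\<Sum>k<n. \<Sum>l<n. X i l * Y l k * Z k j) = (\<Sum>l<n. \<Sum>k<n. X i l * Y l k * Z k j)"
    by (rule sum.swap)
  then show "mat_mul n (mat_mul n X Y) Z i j = mat_mul n X (mat_mul n Y Z) i j"
    by (simp add: mat_mul_def sum_distrib_left sum_distrib_right mult.assoc)
qed

lemma mat_mul_id_row: "(\<Sum>k<n. mat_id n i k * f k) = (if i < n then f i else 0)"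
  by (cases "i < n") (simp_all add: mat_id_unit(1) mat_id_outside)

lemma mat_mul_id_col: "(\<Sum>k<n. f k * mat_id n k j) = (if j < n then f j else 0)"
  by (cases "j < n") (simp_all add: mat_id_unit(2) mat_id_outside)

lemma mat_mul_id:
  assumes "X \<in> mats n"
  shows "mat_mul n (mat_id n) X = X" "mat_mul n X (mat_id n) = X"
  using assms by (auto simp: mat_mul_def mat_mul_id_row mat_mul_id_col fun_eq_iff mats_def)

lemma orth_subset_mats: "m \<le> n \<Longrightarrow> orth n m \<subseteq> mats n"
  by (auto simp: orth_def mats_def mat_id_outside)

lemma mats_transpose: "X \<in> mats n \<Longrightarrow> mat_transpose X \<in> mats n"
  by (auto simp: mats_def)

lemma orth_transpose: "X \<in> orth n m \<Longrightarrow> mat_transpose X \<in> orth n m"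
  by (auto simp: orth_def mat_id_commute)

lemma transpose_mat_mul: "mat_transpose (mat_mul n X Y) = mat_mul n (mat_transpose Y) (mat_transpose X)"
  by (simp add: mat_mul_def mult.commute)

lemma mat_mul_cancel:
  assumes "A \<in> mats n" "B \<in> mats n" "mat_mul n X Y = mat_id n"
  shows "mat_mul n (mat_mul n A X) (mat_mul n Y B) = mat_mul n A B"
proof -
  have "mat_mul n (mat_mul n A X) (mat_mul n Y B) = mat_mul n (mat_mul n A (mat_mul n X Y)) B"
    by (simp add: mat_mul_assoc)
  then show ?thesis using assms by (simp add: mat_mul_id)
qed

lemma orth_mult:
  assumes "m \<le> n" and X: "X \<in> orth n m" and Y: "Y \<in> orth n m"
  shows "mat_mul n X Y \<in> orth n m"
proof -
  have mats: "X \<in> mats n" "Y \<in> mats n" "mat_transpose X \<in> mats n" "mat_transpose Y \<in> mats n"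
    using orth_subset_mats[OF \<open>m \<le> n\<close>] X Y by (auto intro: mats_transpose)
  have "mat_mul n X Y i j = mat_id n i j" if "m \<le> i \<or> m \<le> j" for i j
    using that
  proof
    assume "m \<le> i"
    then have "X i k = mat_id n i k" "Y i j = mat_id n i j" for k using X Y by (auto simp: orth_def)
    then show ?thesis by (simp add: mat_mul_def mat_mul_id_row mat_id_outside)
  next
    assume "m \<le> j"
    then have "Y k j = mat_id n k j" "X i j = mat_id n i j" for k using X Y by (auto simp: orth_def)
    then show ?thesis by (simp add: mat_mul_def mat_mul_id_col mat_id_outside)
  qed
  moreover have "mat_mul n (mat_mul n X Y) (mat_transpose (mat_mul n X Y)) = mat_id n"
    unfolding transpose_mat_mul using X Y mats by (subst mat_mul_cancel) (auto simp: orth_def)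
  moreover have "mat_mul n (mat_transpose (mat_mul n X Y)) (mat_mul n X Y) = mat_id n"
    unfolding transpose_mat_mul using X Y mats by (subst mat_mul_cancel) (auto simp: orth_def)
  ultimately show ?thesis by (simp add: orth_def)
qed

lemma mat_id_in_mats: "mat_id n \<in> mats n"
  by (auto simp: mats_def mat_id_def)

lemma mat_id_in_orth: "mat_id n \<in> orth n m"
proof -
  have "mat_transpose (mat_id n) = mat_id n" by (simp add: fun_eq_iff mat_id_commute)
  then show ?thesis by (simp add: orth_def mat_mul_id mat_id_in_mats)
qed

lemma mat_group_orth:
  assumes "m \<le> n"
  shows "mat_group n (orth n m)"
proof -
  have "\<exists>Y\<in>orth n m. mat_mul n X Y = mat_id n \<and> mat_mul n Y X = mat_id n" if "X \<in> orth n m" for X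
  proof (intro bexI conjI)
    show "mat_mul n X (mat_transpose X) = mat_id n" "mat_mul n (mat_transpose X) X = mat_id n"
      using that by (simp_all add: orth_def)
  qed (rule orth_transpose[OF that])
  then show ?thesis
    using assms by (simp add: mat_group_def orth_subset_mats mat_id_in_orth orth_mult)
qed

lemma orth_mono: "m \<le> m' \<Longrightarrow> orth n m \<subseteq> orth n m'"
  unfolding orth_def by (blast intro: le_trans)

section \<open>Closedness and compactness of the orthogonal groups\<close>

lemma continuous_on_entry: "continuous_on S (\<lambda>X :: rmat. X i j)"
proof -
  have "continuous_on S (\<lambda>X :: rmat. X i)"
    by (rule continuous_on_product_then_coordinatewise) (rule continuous_on_id)
  then show ?thesis by (rule continuous_on_product_then_coordinatewise)
qed

lemma closed_orth: "closed (orth n m)"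
proof -
  have 1: "closed {X :: rmat. X i j = c}" for i j c
    by (intro closed_Collect_eq continuous_on_entry continuous_intros)
  have 2: "closed {X :: rmat. (\<Sum>k<n. X i k * X j k) = c}"
    "closed {X :: rmat. (\<Sum>k<n. X k i * X k j) = c}" for i j c
    by (intro closed_Collect_eq continuous_on_entry continuous_intros)+
  have "orth n m = {X. \<forall>i j. m \<le> i \<or> m \<le> j \<longrightarrow> X i j = mat_id n i j} \<inter>
     {X. \<forall>i j. (\<Sum>k<n. X i k * X j k) = mat_id n i j} \<inter>
     {X. \<forall>i j. (\<Sum>k<n. X k i * X k j) = mat_id n i j}"
    by (auto simp: orth_def mat_mul_def fun_eq_iff)
  moreover have "closed \<dots>"
    by (intro closed_Int closed_Collect_all closed_Collect_imp 1 2) auto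
  ultimately show ?thesis by simp
qed

lemma compact_funcset:
  fixes K :: "'c::topological_space set"
  assumes "compact K"
  shows "compact {f :: 'b \<Rightarrow> 'c. \<forall>x. f x \<in> K}"
proof -
  have "compactin (product_topology (\<lambda>_. euclidean) UNIV) (PiE UNIV (\<lambda>_ :: 'b. K))"
    using assms by (subst compactin_PiE) simp
  then show ?thesis
    by (simp add: euclidean_product_topology PiE_UNIV_domain Pi_def)
qed

text \<open>The rows of an orthogonal matrix are unit vectors, so all entries lie in [-1, 1]. The
  cube of all such functions is compact by Tychonoff, applied once to rows and once to matrices, and
  the group is closed in it.\<close>

lemma compact_orth:
  assumes "m \<le> n"
  shows "compact (orth n m)"
proof -
  define K :: "rmat set" where "K = {X. \<forall>i. X i \<in> {v. \<forall>j. v j \<in> {-1..1}}}"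
  have "compact K" unfolding K_def by (intro compact_funcset compact_Icc)
  moreover have "orth n m \<subseteq> K"
  proof
    fix X assume X: "X \<in> orth n m"
    have "\<bar>X i j\<bar> \<le> 1" for i j
    proof (cases "j < n \<and> i < n")
      case True
      have "X i j * X i j \<le> (\<Sum>k<n. X i k * X i k)"
        using True by (intro member_le_sum) auto
      also have "\<dots> = mat_mul n X (mat_transpose X) i i" by (simp add: mat_mul_def)
      also have "\<dots> = 1" using X True by (simp add: orth_def mat_id_def)
      finally show ?thesis by (simp add: power2_eq_square[symmetric] abs_square_le_1)
    next
      case False
      then have "X i j = 0" using X orth_subset_mats[OF assms] by (auto simp: mats_def)
      then show ?thesis by simp
    qed
    then have "- 1 \<le> X i j \<and> X i j \<le> 1" for i j by (simp add: abs_le_iff minus_le_iff[of "X i j"])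
    then show "X \<in> K" by (simp add: K_def)
  qed
  ultimately show ?thesis
    using compact_Int_closed[OF _ closed_orth, of K n m] by (simp add: Int_absorb1)
qed

section \<open>Reflections and the Lie algebra of O(m)\<close>

definition householder :: "nat \<Rightarrow> (nat \<Rightarrow> real) \<Rightarrow> rmat"
  where "householder n u = (\<lambda>p q. mat_id n p q - 2 * u p * u q)"

lemma householder_mult:
  assumes "u \<in> vecs n" "v \<in> vecs n"
  shows "mat_mul n (householder n u) (householder n v) p q =
    mat_id n p q - 2 * u p * u q - 2 * v p * v q + 4 * dot n u v * u p * v q"
proof -
  have "mat_mul n (householder n u) (householder n v) p q =
     (\<Sum>k<n. mat_id n p k * mat_id n k q) - (\<Sum>k<n. mat_id n p k * (2 * v k * v q))
     - (\<Sum>k<n. 2 * u p * u k * mat_id n k q) + (\<Sum>k<n. 4 * (u k * v k) * u p * v q)"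
    by (simp add: mat_mul_def householder_def sum.distrib[symmetric] sum_subtractf[symmetric] algebra_simps)
  also have "(\<Sum>k<n. 4 * (u k * v k) * u p * v q) = 4 * dot n u v * u p * v q"
    by (simp add: dot_def sum_distrib_left sum_distrib_right mult.assoc)
  finally show ?thesis using assms
    by (auto simp: mat_mul_id_row mat_mul_id_col mat_id_outside vecs_def)
qed

text \<open>For a unit vector u = v the rank-one terms of the product formula cancel, so the
  reflection is symmetric and its own inverse. Since u lives in the first m coordinates, nothing
  changes outside that block.\<close>

lemma householder_in_orth:
  assumes "m \<le> n" "u \<in> vecs m" "dot n u u = 1"
  shows "householder n u \<in> orth n m"
proof -
  have "mat_transpose (householder n u) = householder n u"
    by (simp add: householder_def mat_id_commute mult_ac fun_eq_iff)
  moreover have "u \<in> vecs n" using assms by (auto simp: vecs_def)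
  ultimately show ?thesis
    using assms by (auto simp: orth_def fun_eq_iff householder_mult) (auto simp: householder_def vecs_def)
qed

lemma skew_mono: "m \<le> n \<Longrightarrow> skew m \<subseteq> skew n"
  by (auto simp: skew_def mats_def)

lemma subspace_skew: "subspace (skew m)"
proof -
  have "X + Y \<in> skew m" if "X \<in> skew m" "Y \<in> skew m" for X Y
  proof (rule skewI)
    show "(X + Y) j i = - (X + Y) i j" for i j
      using skew_swap[OF that(1), of i j] skew_swap[OF that(2), of i j] by simp
  qed (use that in \<open>auto simp: mats_def skew_outside\<close>)
  moreover have "c *\<^sub>R X \<in> skew m" if "X \<in> skew m" for c X
  proof (rule skewI)
    show "(c *\<^sub>R X) j i = - (c *\<^sub>R X) i j" for i j
      using skew_swap[OF that, of i j] by simp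
  qed (use that in \<open>auto simp: mats_def skew_outside\<close>)
  moreover have "0 \<in> skew m" by (intro skewI) (auto simp: mats_def)
  ultimately show ?thesis by (simp add: subspace_def)
qed

lemma wedge_in_skew: "u \<in> vecs m \<Longrightarrow> v \<in> vecs m \<Longrightarrow> wedge u v \<in> skew m"
  by (intro skewI) (auto simp: mats_def wedge_def vecs_def)

lemma unit_in_vecs: "i < m \<Longrightarrow> unit i \<in> vecs m"
  by (auto simp: unit_def vecs_def)

text \<open>Every pair of indices occurs in both orders, which the factor 1/2 compensates. Summing
  over a full square avoids any ordering of the indices.\<close>

lemma skew_expansion:
  assumes "X \<in> skew m"
  shows "X = (\<Sum>(i, j)\<in>{..<m} \<times> {..<m}. (1/2 * X i j) *\<^sub>R wedge (unit i) (unit j))"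
proof (intro ext)
  fix p q
  have X: "X i j = 0" if "\<not> (i < m \<and> j < m)" for i j
    using that skew_outside[OF assms, of i j] by auto
  have XT: "X q p = - X p q" using assms by (rule skew_swap)
  have u: "unit i p = unit p i" for i p by (simp add: unit_def)
  define Z where "Z i j = 1/2 * X i j" for i j
  have Z: "Z i j = 0" if "\<not> (i < m \<and> j < m)" for i j using X[OF that] by (simp add: Z_def)
  have "(\<Sum>(i, j)\<in>{..<m} \<times> {..<m}. (1/2 * X i j) *\<^sub>R wedge (unit i) (unit j)) p q =
    (\<Sum>i<m. \<Sum>j<m. Z i j * (unit i p * unit j q - unit j p * unit i q))"
    by (simp add: sum.cartesian_product[symmetric] sum_fun_apply wedge_def Z_def)
  also have "\<dots> = (\<Sum>i<m. \<Sum>j<m. unit q j * (unit p i * Z i j)) - (\<Sum>i<m. \<Sum>j<m. unit p j * (unit q i * Z i j))"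
    by (simp add: u[of _ p] u[of _ q] sum_subtractf[symmetric] algebra_simps del: sum_unit)
  also have "\<dots> = Z p q - Z q p"
    by (cases "p < m"; cases "q < m") (simp_all add: Z)
  also have "\<dots> = X p q" by (simp add: Z_def XT)
  finally show "X p q = (\<Sum>(i, j)\<in>{..<m} \<times> {..<m}. (1/2 * X i j) *\<^sub>R wedge (unit i) (unit j)) p q"
    by simp
qed

text \<open>Entries outside the block are constant along the curve, so their velocities vanish;
  inside, differentiating X X^T = 1 at the identity gives skewness.\<close>

lemma lie_algebra_orth_subset: "lie_algebra n (orth n m) \<subseteq> skew m" if "m \<le> n"
proof
  fix X assume "X \<in> lie_algebra n (orth n m)"
  then obtain \<gamma> where \<gamma>: "\<And>t. \<gamma> t \<in> orth n m" "\<gamma> 0 = mat_id n"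
    and der: "\<And>i j. ((\<lambda>t. \<gamma> t i j) has_real_derivative X i j) (at 0)"
    by (auto simp: lie_algebra_def)
  have zero: "X i j = 0" if "m \<le> i \<or> m \<le> j" for i j
  proof -
    have "(\<lambda>t. \<gamma> t i j) = (\<lambda>t. mat_id n i j)" using \<gamma>(1) that by (auto simp: orth_def)
    then have "((\<lambda>t. \<gamma> t i j) has_real_derivative 0) (at 0)" by simp
    with der show ?thesis by (rule DERIV_unique)
  qed
  have "X j i = - X i j" for i j
  proof (cases "i < m \<and> j < m")
    case True
    then have "i < n" "j < n" using \<open>m \<le> n\<close> by auto
    have "mat_mul n (\<gamma> t) (mat_transpose (\<gamma> t)) i j = mat_id n i j" for t
      using \<gamma>(1)[of t] by (simp add: orth_def)
    then have "((\<lambda>t. \<Sum>k<n. \<gamma> t i k * \<gamma> t j k) has_real_derivative 0) (at 0)"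
      by (simp add: mat_mul_def)
    moreover have "((\<lambda>t. \<Sum>k<n. \<gamma> t i k * \<gamma> t j k) has_real_derivative
        (\<Sum>k<n. X i k * \<gamma> 0 j k + X j k * \<gamma> 0 i k)) (at 0)"
      by (intro DERIV_sum DERIV_mult der)
    ultimately have "(\<Sum>k<n. X i k * \<gamma> 0 j k + X j k * \<gamma> 0 i k) = 0"
      by (rule DERIV_unique[rotated])
    then show ?thesis using \<open>i < n\<close> \<open>j < n\<close> by (simp add: \<gamma>(2) mat_id_unit sum.distrib)
  next
    case False
    then show ?thesis using zero[of i j] zero[of j i] by auto
  qed
  then show "X \<in> skew m" by (rule skewI[rotated]) (use zero in \<open>auto simp: mats_def\<close>)
qed

text \<open>At the identity the velocity of a product of two curves is the sum of their
  velocities.\<close>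

lemma lie_algebra_orth_add:
  assumes "m \<le> n" "X \<in> lie_algebra n (orth n m)" "Y \<in> lie_algebra n (orth n m)"
  shows "X + Y \<in> lie_algebra n (orth n m)"
proof -
  obtain \<gamma> where \<gamma>: "\<And>t. \<gamma> t \<in> orth n m" "\<gamma> 0 = mat_id n"
    and d\<gamma>: "\<And>i j. ((\<lambda>t. \<gamma> t i j) has_real_derivative X i j) (at 0)"
    using assms by (auto simp: lie_algebra_def)
  obtain \<delta> where \<delta>: "\<And>t. \<delta> t \<in> orth n m" "\<delta> 0 = mat_id n"
    and d\<delta>: "\<And>i j. ((\<lambda>t. \<delta> t i j) has_real_derivative Y i j) (at 0)"
    using assms by (auto simp: lie_algebra_def)
  have mats: "X \<in> mats n" "Y \<in> mats n"
    using assms lie_algebra_orth_subset[OF \<open>m \<le> n\<close>] skew_subset_mats[OF \<open>m \<le> n\<close>] by blast+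
  have "((\<lambda>t. mat_mul n (\<gamma> t) (\<delta> t) i j) has_real_derivative (X + Y) i j) (at 0)" for i j
  proof -
    have "((\<lambda>t. mat_mul n (\<gamma> t) (\<delta> t) i j) has_real_derivative
        (\<Sum>k<n. X i k * \<delta> 0 k j + Y k j * \<gamma> 0 i k)) (at 0)"
      unfolding mat_mul_def by (intro DERIV_sum DERIV_mult d\<gamma> d\<delta>)
    moreover have "(\<Sum>k<n. X i k * \<delta> 0 k j + Y k j * \<gamma> 0 i k) = (X + Y) i j"
      using mats mat_mul_id_row[of n i "\<lambda>k. Y k j"] mat_mul_id_col[where f = "X i" and n = n and j = j]
      by (auto simp: \<gamma> \<delta> sum.distrib mult.commute mats_def)
    ultimately show ?thesis by simp
  qed
  moreover have "mat_mul n (\<gamma> 0) (\<delta> 0) = mat_id n"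
    by (simp add: \<gamma> \<delta> mat_mul_id mat_id_in_mats)
  ultimately show ?thesis
    unfolding lie_algebra_def using orth_mult[OF \<open>m \<le> n\<close> \<gamma>(1) \<delta>(1)]
    by (intro CollectI exI[of _ "\<lambda>t. mat_mul n (\<gamma> t) (\<delta> t)"]) auto
qed

lemma lie_algebra_scale:
  assumes "X \<in> lie_algebra n G"
  shows "c *\<^sub>R X \<in> lie_algebra n G"
proof -
  obtain \<gamma> where \<gamma>: "\<And>t. \<gamma> t \<in> G" "\<gamma> 0 = mat_id n"
    and der: "\<And>i j. ((\<lambda>t. \<gamma> t i j) has_real_derivative X i j) (at 0)"
    using assms by (auto simp: lie_algebra_def)
  have "((\<lambda>t. \<gamma> (c * t) i j) has_real_derivative (c *\<^sub>R X) i j) (at 0)" for i j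
  proof -
    have "((\<lambda>t. \<gamma> t i j) \<circ> (\<lambda>t. c * t) has_real_derivative X i j * c) (at 0)"
      by (rule DERIV_chain) (use der in \<open>auto intro!: derivative_eq_intros\<close>)
    then show ?thesis by (simp add: o_def mult.commute)
  qed
  then show ?thesis
    unfolding lie_algebra_def using \<gamma> by (intro CollectI exI[of _ "\<lambda>t. \<gamma> (c * t)"]) auto
qed

lemma zero_in_lie_algebra: "mat_id n \<in> G \<Longrightarrow> 0 \<in> lie_algebra n G"
  unfolding lie_algebra_def by (intro CollectI exI[of _ "\<lambda>_. mat_id n"]) auto

lemma wedge_self [simp]: "wedge u u = 0"
  by (auto simp: wedge_def fun_eq_iff)

lemma wedge_unit_in_lie_algebra:
  assumes "m \<le> n" "i < m" "j < m"
  shows "wedge (unit i) (unit j) \<in> lie_algebra n (orth n m)"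
proof (cases "i = j")
  case True
  then show ?thesis by (simp add: zero_in_lie_algebra mat_id_in_orth)
next
  case False
  \<comment> \<open>Two reflections compose to a rotation by twice the angle between their vectors,
    hence the half angle: the curve is the rotation by t in the plane of the two coordinates, with
    velocity exactly the wedge. Reflecting first in \<open>unit j\<close>, which is u(0), makes the
    curve start at the identity.\<close>
  define u where "u t = (\<lambda>p. cos (t/2) * unit j p + sin (t/2) * unit i p)" for t
  have u0: "u 0 = unit j" by (simp add: u_def)
  have vecs: "u t \<in> vecs m" "unit j \<in> vecs m" for t
    using assms by (auto simp: u_def vecs_def unit_def)
  then have vecs': "u t \<in> vecs n" "unit j \<in> vecs n" for t
    using \<open>m \<le> n\<close> by (auto simp: vecs_def)
  have ij: "i < n" "j < n" using assms by auto
  have uj: "dot n (u t) (unit j) = cos (t/2)" for t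
    using ij False by (simp add: dot_def u_def) (simp add: unit_def)
  have jj: "dot n (unit j) (unit j) = 1" using ij by (simp add: dot_def) (simp add: unit_def)
  have uu: "dot n (u t) (u t) = 1" for t
  proof -
    have "dot n (u t) (u t) = cos (t/2) * dot n (u t) (unit j) + sin (t/2) * dot n (u t) (unit i)"
      by (simp add: dot_def u_def[of t] sum_distrib_left sum.distrib[symmetric] algebra_simps)
    also have "dot n (u t) (unit i) = sin (t/2)"
      using ij False by (simp add: dot_def u_def) (simp add: unit_def)
    finally show ?thesis by (simp add: uj power2_eq_square[symmetric])
  qed
  define \<gamma> where "\<gamma> t = mat_mul n (householder n (u t)) (householder n (unit j))" for t
  have \<gamma>: "\<gamma> t p q = mat_id n p q - 2 * u t p * u t q - 2 * unit j p * unit j q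
      + 4 * cos (t/2) * u t p * unit j q" for t p q
    by (simp add: \<gamma>_def householder_mult vecs' uj)
  have "\<gamma> t \<in> orth n m" for t
    unfolding \<gamma>_def by (intro orth_mult householder_in_orth vecs uu jj assms)
  moreover have "\<gamma> 0 = mat_id n" by (simp add: fun_eq_iff \<gamma> u0)
  moreover have "((\<lambda>t. \<gamma> t p q) has_real_derivative wedge (unit i) (unit j) p q) (at 0)" for p q
    unfolding \<gamma> u_def
    by (rule derivative_eq_intros refl | simp)+ (simp add: wedge_def algebra_simps)
  ultimately show ?thesis
    unfolding lie_algebra_def by blast
qed

lemma lie_algebra_orth:
  assumes "m \<le> n"
  shows "lie_algebra n (orth n m) = skew m"
proof (intro equalityI lie_algebra_orth_subset[OF assms] subsetI)
  have sub: "subspace (lie_algebra n (orth n m))"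
    using assms by (simp add: subspace_def lie_algebra_orth_add lie_algebra_scale
        zero_in_lie_algebra mat_id_in_orth)
  fix X assume "X \<in> skew m"
  then have X: "X = (\<Sum>(i, j)\<in>{..<m} \<times> {..<m}. (1/2 * X i j) *\<^sub>R wedge (unit i) (unit j))"
    by (rule skew_expansion)
  show "X \<in> lie_algebra n (orth n m)"
    by (subst X, rule subspace_sum[OF sub])
      (auto intro!: lie_algebra_scale wedge_unit_in_lie_algebra assms)
qed

subsection \<open>The Killing form\<close>

lemma mat_mul_in_mats: "X \<in> mats n \<Longrightarrow> Y \<in> mats n \<Longrightarrow> mat_mul n X Y \<in> mats n"
  by (auto simp: mats_def mat_mul_def)

lemma bracket_in_skew:
  assumes "X \<in> skew n" "Y \<in> skew n"
  shows "bracket n X Y \<in> skew n"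
proof (rule skewI)
  have "X \<in> mats n" "Y \<in> mats n" using assms skew_subset_mats by auto
  then show "bracket n X Y \<in> mats n"
    using mat_mul_in_mats[of X n Y] mat_mul_in_mats[of Y n X] by (auto simp: bracket_def mats_def)
  fix i j
  have "X j k * Y k i = Y i k * X k j" "Y j k * X k i = X i k * Y k j" for k
    using skew_swap[OF assms(1), of k j] skew_swap[OF assms(2), of i k]
      skew_swap[OF assms(2), of k j] skew_swap[OF assms(1), of i k] by simp_all
  then show "bracket n X Y j i = - bracket n X Y i j"
    by (simp add: bracket_def mat_mul_def)
qed

lemma mat_mul_add:
  "mat_mul n (A + B) C = mat_mul n A C + mat_mul n B C"
  "mat_mul n A (B + C) = mat_mul n A B + mat_mul n A C"
  by (simp_all add: mat_mul_def fun_eq_iff distrib_left distrib_right sum.distrib)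

lemma mat_mul_diff:
  "mat_mul n (A - B) C = mat_mul n A C - mat_mul n B C"
  "mat_mul n A (B - C) = mat_mul n A B - mat_mul n A C"
  by (simp_all add: mat_mul_def fun_eq_iff left_diff_distrib right_diff_distrib sum_subtractf)

lemma mat_mul_scaleR:
  "mat_mul n (c *\<^sub>R A) B = c *\<^sub>R mat_mul n A B"
  "mat_mul n A (c *\<^sub>R B) = c *\<^sub>R mat_mul n A B"
  by (simp_all add: mat_mul_def fun_eq_iff sum_distrib_left mult.assoc mult.left_commute)

lemma linear_bracket: "linear (bracket n X)"
  by (intro linearI) (simp_all add: bracket_def mat_mul_add mat_mul_scaleR scaleR_diff_right)

lemma mat_mul_wedge:
  "mat_mul n A (wedge u v) p q = mat_vec n A u p * v q - mat_vec n A v p * u q"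
  "mat_mul n (wedge u v) A p q =
    u p * mat_vec n (mat_transpose A) v q - v p * mat_vec n (mat_transpose A) u q"
  by (simp_all add: mat_mul_def wedge_def mat_vec_def sum_distrib_left sum_distrib_right
      flip: sum_subtractf)
    (simp_all add: algebra_simps)

lemma mat_vec_unit: "i < n \<Longrightarrow> mat_vec n A (unit i) = (\<lambda>p. A p i)"
  by (simp add: mat_vec_def)

lemma unit_self [simp]: "unit i i = 1"
  by (simp add: unit_def)

text \<open>Entry (i, j) is the coordinate that pairs with the wedge of units i and j, so this is
  all that the trace requires. Of X Y E - X E Y - Y E X + E Y X, the two middle terms reduce to
  products of entries because skew matrices have zero diagonal. The term with
  \<open>unit i j\<close> accounts for i = j, where the wedge is 0.\<close>

lemma double_bracket_entry:
  assumes X: "X \<in> skew n" and Y: "Y \<in> skew n" and ij: "i < n" "j < n"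
  shows "bracket n X (bracket n Y (wedge (unit i) (unit j))) i j =
    mat_mul n X Y i i + mat_mul n Y X j j
    - unit i j * (mat_mul n X Y i i + mat_mul n Y X i i) + 2 * (X i j * Y i j)"
proof -
  let ?E = "wedge (unit i) (unit j)"
  have conj: "mat_mul n A (mat_mul n ?E B) i j = - (A i j * B i j)"
    if A: "A \<in> skew n" for A B
  proof -
    have "mat_mul n A (mat_mul n ?E B) i j = mat_mul n (mat_mul n A ?E) B i j"
      by (simp add: mat_mul_assoc)
    also have "\<dots> = (\<Sum>k<n. (A i i * unit j k - A i j * unit i k) * B k j)"
      using ij unfolding mat_mul_def[of n "mat_mul n A ?E"] by (simp add: mat_mul_wedge mat_vec_unit)
    also have "\<dots> = - (\<Sum>k<n. unit i k * (A i j * B k j))"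
      by (simp add: skew_diagonal[OF A] sum_negf algebra_simps del: sum_unit)
    also have "\<dots> = - (A i j * B i j)" using ij by simp
    finally show ?thesis .
  qed
  have unit_eq: "unit j i * f j = unit i j * f i" "unit i j * f j = unit i j * f i" for f :: "nat \<Rightarrow> real"
    by (auto simp: unit_def)
  have "bracket n X (bracket n Y ?E) = mat_mul n (mat_mul n X Y) ?E - mat_mul n X (mat_mul n ?E Y)
      - (mat_mul n Y (mat_mul n ?E X) - mat_mul n ?E (mat_mul n Y X))"
    by (simp add: bracket_def mat_mul_diff mat_mul_assoc)
  then have "bracket n X (bracket n Y ?E) i j =
      (mat_mul n X Y i i - mat_mul n X Y i j * unit i j) + X i j * Y i j
      - (- (Y i j * X i j) - (mat_mul n Y X j j - unit j i * mat_mul n Y X i j))"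
    using ij by (simp add: conj[OF X] conj[OF Y] mat_mul_wedge mat_vec_unit)
  then show ?thesis
    by (simp add: unit_eq[of "\<lambda>k. mat_mul n X Y i k"] unit_eq[of "\<lambda>k. mat_mul n Y X i k"] algebra_simps)
qed

text \<open>The classical formula B(X, Y) = (n - 2) tr(X Y) for so(n), with tr(X Y) written as minus
  the entrywise product.\<close>

lemma ip_skew:
  assumes X: "X \<in> skew n" and Y: "Y \<in> skew n"
  shows "ip n (skew n) X Y = (real n - 2) * (\<Sum>i<n. \<Sum>j<n. X i j * Y i j)"
proof -
  let ?S = "\<Sum>i<n. \<Sum>j<n. X i j * Y i j"
  let ?f = "\<lambda>Z. bracket n X (bracket n Y Z)"
  have f: "linear ?f" "?f ` skew n \<subseteq> skew n"
    using linear_compose[OF linear_bracket linear_bracket, of n X n Y] bracket_in_skew X Y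
    by (auto simp: o_def)
  have tr: "(\<Sum>i<n. mat_mul n A B i i) = - (\<Sum>i<n. \<Sum>j<n. A i j * B i j)" if "B \<in> skew n" for A B
  proof -
    have "A i j * B j i = - (A i j * B i j)" for i j using skew_swap[OF that, of j i] by simp
    then show ?thesis by (simp add: mat_mul_def sum_negf)
  qed
  have S: "(\<Sum>i<n. mat_mul n X Y i i) = - ?S" "(\<Sum>i<n. mat_mul n Y X i i) = - ?S"
    using tr[OF Y, of X] tr[OF X, of Y] by (simp_all add: mult.commute)
  have "killing_form n (skew n) X Y =
      (\<Sum>ij\<in>{..<n} \<times> {..<n}. (\<lambda>ij Z. 1/2 * Z (fst ij) (snd ij)) ij
        (?f ((\<lambda>ij. wedge (unit (fst ij)) (unit (snd ij))) ij)))"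
    unfolding killing_form_def
    by (rule trace_on_coordinates[OF subspace_skew _ _ linear_scaled_entry _ f])
      (use skew_expansion[of _ n] in \<open>auto intro!: wedge_in_skew unit_in_vecs simp: case_prod_unfold\<close>)
  also have "\<dots> = 1/2 * (\<Sum>i<n. \<Sum>j<n. ?f (wedge (unit i) (unit j)) i j)"
    by (simp add: sum.cartesian_product sum_distrib_left case_prod_unfold)
  also have "(\<Sum>i<n. \<Sum>j<n. ?f (wedge (unit i) (unit j)) i j) =
      (\<Sum>i<n. \<Sum>j<n. mat_mul n X Y i i) + (\<Sum>i<n. \<Sum>j<n. mat_mul n Y X j j)
      - (\<Sum>i<n. \<Sum>j<n. unit i j * (mat_mul n X Y i i + mat_mul n Y X i i)) + 2 * ?S"
  proof -
    have "(\<Sum>i<n. \<Sum>j<n. ?f (wedge (unit i) (unit j)) i j) =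
        (\<Sum>i<n. \<Sum>j<n. mat_mul n X Y i i + mat_mul n Y X j j
          - unit i j * (mat_mul n X Y i i + mat_mul n Y X i i) + 2 * (X i j * Y i j))"
      by (intro sum.cong refl double_bracket_entry[OF X Y]) auto
    then show ?thesis
      by (simp add: sum.distrib sum_subtractf sum_distrib_left del: sum_unit sum_constant)
  qed
  \<comment> \<open>The first two sums are -n S each, and the diagonal correction and the last term
    are 2 S each. The factor 1/2 of the redundant family then leaves (2 - n) S.\<close>
  also have "\<dots> = 2 * (2 - real n) * ?S"
    by (simp add: sum.distrib S sum_distrib_left[symmetric] algebra_simps)
  finally show ?thesis by (simp add: ip_def algebra_simps)
qed

subsection \<open>The isotropy modules\<close>

lemma mat_inverse_orth:
  assumes "m \<le> n" "h \<in> orth n m"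
  shows "mat_inverse n h = mat_transpose h"
  unfolding mat_inverse_def
proof (rule the_equality)
  have h: "mat_mul n h (mat_transpose h) = mat_id n" "mat_mul n (mat_transpose h) h = mat_id n"
    using assms by (auto simp: orth_def)
  have ht: "mat_transpose h \<in> mats n"
    using orth_transpose[OF assms(2)] orth_subset_mats[OF assms(1)] by blast
  show "mat_transpose h \<in> mats n \<and> mat_mul n h (mat_transpose h) = mat_id n \<and>
      mat_mul n (mat_transpose h) h = mat_id n"
    using h ht by blast
  fix Y assume Y: "Y \<in> mats n \<and> mat_mul n h Y = mat_id n \<and> mat_mul n Y h = mat_id n"
  have "Y = mat_mul n Y (mat_mul n h (mat_transpose h))" using Y h by (simp add: mat_mul_id)
  also have "\<dots> = mat_mul n (mat_mul n Y h) (mat_transpose h)" by (simp only: mat_mul_assoc)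
  also have "\<dots> = mat_transpose h" using Y mat_mul_id(1)[OF ht] by simp
  finally show "Y = mat_transpose h" .
qed

text \<open>With the transpose as inverse, h (u v^T - v u^T) h^T moves \<open>h\<close> onto both
  vectors.\<close>

lemma Ad_wedge:
  assumes "m \<le> n" "h \<in> orth n m"
  shows "Ad n h (wedge u v) = wedge (mat_vec n h u) (mat_vec n h v)"
proof (intro ext)
  fix p q
  have 1: "(\<Sum>k<n. (A * v k - B * u k) * h q k) = A * mat_vec n h v q - B * mat_vec n h u q" for A B
    by (simp add: mat_vec_def sum_subtractf[symmetric] sum_distrib_left algebra_simps)
  have "Ad n h (wedge u v) p q =
     (\<Sum>k<n. (mat_vec n h u p * v k - mat_vec n h v p * u k) * h q k)"
    using mat_inverse_orth[OF assms]
    unfolding Ad_def mat_mul_def[of n "mat_mul n h (wedge u v)"] by (simp add: mat_mul_wedge)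
  also have "\<dots> = wedge (mat_vec n h u) (mat_vec n h v) p q"
    by (simp add: wedge_def 1)
  finally show "Ad n h (wedge u v) p q = wedge (mat_vec n h u) (mat_vec n h v) p q" .
qed

lemma Ad_scaleR: "Ad n h (c *\<^sub>R X) = c *\<^sub>R Ad n h X"
  by (simp add: Ad_def mat_mul_scaleR)

lemma mat_vec_orth_in_vecs:
  assumes "h \<in> orth n m" "v \<in> vecs m"
  shows "mat_vec n h v \<in> vecs m"
proof -
  have "mat_vec n h v i = 0" if "m \<le> i" for i
  proof -
    have "mat_vec n h v i = (\<Sum>p<n. mat_id n i p * v p)"
      using assms that by (simp add: mat_vec_def orth_def)
    then show ?thesis using assms that by (simp add: mat_mul_id_row vecs_def)
  qed
  then show ?thesis by (simp add: vecs_def)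
qed

lemma mat_vec_orth_unit:
  assumes "h \<in> orth n m" "m \<le> c" "c < n"
  shows "mat_vec n h (unit c) = unit c"
proof
  fix p
  have "mat_vec n h (unit c) p = mat_id n p c" using assms by (simp add: mat_vec_unit orth_def)
  then show "mat_vec n h (unit c) p = unit c p" using assms by (simp add: mat_id_unit(2))
qed

lemma mat_vec_householder:
  assumes "v \<in> vecs n"
  shows "mat_vec n (householder n u) v = v - (2 * dot n u v) *\<^sub>R u"
proof
  fix i
  have "mat_vec n (householder n u) v i = (\<Sum>p<n. mat_id n i p * v p) - 2 * u i * dot n u v"
    by (simp add: mat_vec_def householder_def dot_def left_diff_distrib sum_subtractf
        sum_distrib_left mult.assoc)
  then show "mat_vec n (householder n u) v i = (v - (2 * dot n u v) *\<^sub>R u) i"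
    using assms by (simp add: mat_mul_id_row vecs_def)
qed

lemma linear_wedge_left: "linear (\<lambda>u. wedge u v)"
  by (intro linearI) (simp_all add: wedge_def fun_eq_iff algebra_simps)

lemma subspace_vecs: "subspace (vecs m)"
  by (auto simp: subspace_def vecs_def)

lemma vecs_mono: "m \<le> n \<Longrightarrow> vecs m \<subseteq> vecs n"
  by (auto simp: vecs_def)

lemma vecs_expansion:
  assumes "v \<in> vecs m"
  shows "v = (\<Sum>i<m. v i *\<^sub>R unit i)"
proof
  fix p
  have "(\<Sum>i<m. v i *\<^sub>R unit i) p = (\<Sum>i<m. v i * unit p i)"
    by (simp add: sum_fun_apply unit_def eq_commute[of p])
  then show "v p = (\<Sum>i<m. v i *\<^sub>R unit i) p" using assms by (simp add: vecs_def)
qed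

lemma dot_unit: "c < n \<Longrightarrow> dot n v (unit c) = v c" "c < n \<Longrightarrow> dot n (unit c) v = v c"
  by (simp_all add: dot_def)

lemma dot_commute: "dot n u v = dot n v u"
  by (simp add: dot_def mult.commute)

lemma bracket_wedge:
  "bracket n (wedge a b) (wedge c d) = dot n b c *\<^sub>R wedge a d - dot n b d *\<^sub>R wedge a c
     - dot n a c *\<^sub>R wedge b d + dot n a d *\<^sub>R wedge b c"
proof -
  have mv: "mat_vec n (wedge a b) c p = a p * dot n b c - b p * dot n a c" for a b c p
    by (simp add: mat_vec_def wedge_def dot_def left_diff_distrib sum_subtractf sum_distrib_left mult.assoc)
  show ?thesis
    by (simp add: bracket_def fun_eq_iff mat_mul_wedge(1) mv dot_commute[of n c] dot_commute[of n d])
      (simp add: wedge_def algebra_simps)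
qed

text \<open>The Gram determinant, which is the induced inner product on bivectors; it is doubled
  because (i, j) and (j, i) are both counted.\<close>

lemma sum_wedge_wedge:
  "(\<Sum>i<n. \<Sum>j<n. wedge a b i j * wedge c d i j) = 2 * (dot n a c * dot n b d - dot n a d * dot n b c)"
proof -
  have prod: "dot n a b * dot n c d = (\<Sum>i<n. \<Sum>j<n. (a i * b i) * (c j * d j))" for a b c d
    by (simp add: dot_def sum_product)
  have "(\<Sum>i<n. \<Sum>j<n. wedge a b i j * wedge c d i j) =
    dot n a c * dot n b d - dot n a d * dot n b c - dot n b c * dot n a d + dot n b d * dot n a c"
    unfolding prod
    by (simp add: wedge_def sum_subtractf[symmetric] sum.distrib[symmetric] algebra_simps)
  then show ?thesis by simp
qed

lemma ip_wedge:
  assumes "a \<in> vecs n" "b \<in> vecs n" "c \<in> vecs n" "d \<in> vecs n"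
  shows "ip n (skew n) (wedge a b) (wedge c d) =
    2 * (real n - 2) * (dot n a c * dot n b d - dot n a d * dot n b c)"
  using assms by (simp add: ip_skew wedge_in_skew sum_wedge_wedge algebra_simps)

text \<open>Coordinates count from 0, so the two fixed ones are \<open>k\<close> and
  \<open>Suc k\<close>. The spokes join R^k to the fixed coordinate \<open>c\<close>; the axle joins
  the two fixed coordinates to each other.\<close>

definition spokes :: "nat \<Rightarrow> nat \<Rightarrow> rmat set"
  where "spokes k c = (\<lambda>v. wedge v (unit c)) ` vecs k"

definition axle :: "nat \<Rightarrow> rmat set"
  where "axle k = range (\<lambda>s. s *\<^sub>R wedge (unit k) (unit (Suc k)))"

lemma subspace_spokes: "subspace (spokes k c)"
  unfolding spokes_def by (intro linear_subspace_image linear_wedge_left subspace_vecs)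

text \<open>If v wedge e_c lies in an invariant subspace, subtracting its image under the reflection
  in a unit vector u of R^k leaves 2 (u . v) u wedge e_c. So the subspace contains u wedge e_c for
  every unit u not orthogonal to v, and such u span R^k.\<close>

lemma irreducible_spokes:
  assumes k: "0 < k" and c: "k \<le> c" "c < n"
  shows "irreducible_Ad_module n (orth n k) (spokes k c)"
proof -
  have kn: "k \<le> n" using c by simp
  have inv: "Ad_invariant n (orth n k) (spokes k c)"
    using c by (auto simp: Ad_invariant_def spokes_def Ad_wedge[OF kn] mat_vec_orth_unit
        intro!: imageI mat_vec_orth_in_vecs)
  have nonzero: "spokes k c \<noteq> {0}"
  proof
    assume "spokes k c = {0}"
    then have "wedge (unit 0) (unit c) = 0" using unit_in_vecs[OF k] by (auto simp: spokes_def)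
    then have "wedge (unit 0) (unit c) 0 c = 0" by simp
    then show False using k c by (simp add: wedge_def) (simp add: unit_def)
  qed
  have "spokes k c \<subseteq> U"
    if U: "subspace U" "U \<subseteq> spokes k c" "Ad_invariant n (orth n k) U" "U \<noteq> {0}" for U
  proof -
    obtain X where X: "X \<in> U" "X \<noteq> 0" using U subspace_0[OF U(1)] by blast
    then obtain v where v: "v \<in> vecs k" "X = wedge v (unit c)" using U by (auto simp: spokes_def)
    have "v \<noteq> 0" using X v linear_0[OF linear_wedge_left] by blast
    then obtain i where i: "v i \<noteq> 0" by (auto simp: fun_eq_iff)
    then have "i < k" using v(1) by (auto simp: vecs_def not_le[symmetric])
    note i = i this
    have vn: "v \<in> vecs n" using v vecs_mono[OF kn] by blast
    have reflect: "wedge u (unit c) \<in> U" if u: "u \<in> vecs k" "dot n u u = 1" "dot n u v \<noteq> 0" for u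
    proof -
      let ?h = "householder n u"
      have h: "?h \<in> orth n k" by (rule householder_in_orth[OF kn u(1,2)])
      then have "X - Ad n ?h X \<in> U" using U X by (auto simp: Ad_invariant_def intro: subspace_diff)
      also have "Ad n ?h X = wedge (v - (2 * dot n u v) *\<^sub>R u) (unit c)"
        using c by (simp add: v Ad_wedge[OF kn h] mat_vec_orth_unit[OF h] mat_vec_householder[OF vn])
      also have "X - \<dots> = (2 * dot n u v) *\<^sub>R wedge u (unit c)"
        by (simp add: v linear_diff[OF linear_wedge_left] linear_scale[OF linear_wedge_left])
      finally have "(1 / (2 * dot n u v)) *\<^sub>R ((2 * dot n u v) *\<^sub>R wedge u (unit c)) \<in> U"
        by (rule subspace_scale[OF U(1)])
      then show ?thesis using u(3) by simp
    qed
    have i_in: "wedge (unit i) (unit c) \<in> U"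
      using i kn by (intro reflect unit_in_vecs) (auto simp: dot_unit)
    have "wedge (unit j) (unit c) \<in> U" if j: "j < k" for j
    proof (cases "v j = 0")
      case False
      then show ?thesis using j kn by (intro reflect unit_in_vecs) (auto simp: dot_unit)
    next
      case True
      then have "i \<noteq> j" using i by auto
      \<comment> \<open>When v_j = 0 the unit vector e_j is orthogonal to v. Tilting it towards e_i,
        where v_i is nonzero, makes the reflection usable, and the e_i part is subtracted
        afterwards.\<close>
      define u where "u = (1 / sqrt 2) *\<^sub>R (unit i + unit j)"
      have du: "dot n u w = (w i + w j) / sqrt 2" for w
        using i j kn by (simp add: dot_def u_def distrib_right add_divide_distrib sum.distrib
            flip: sum_divide_distrib)
      have "u \<in> vecs k" using i j by (auto simp: u_def vecs_def unit_def)
      moreover have "u i = 1 / sqrt 2" "u j = 1 / sqrt 2" using \<open>i \<noteq> j\<close> by (auto simp: u_def unit_def)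
      ultimately have "wedge u (unit c) \<in> U"
        using i True by (intro reflect) (auto simp: du)
      then have "sqrt 2 *\<^sub>R wedge u (unit c) - wedge (unit i) (unit c) \<in> U"
        using i_in by (intro subspace_diff subspace_scale U)
      also have "sqrt 2 *\<^sub>R wedge u (unit c) - wedge (unit i) (unit c) = wedge (unit j) (unit c)"
        by (simp add: u_def linear_add[OF linear_wedge_left] linear_scale[OF linear_wedge_left])
      finally show ?thesis .
    qed
    then have "wedge w (unit c) \<in> U" if "w \<in> vecs k" for w
    proof -
      have "wedge w (unit c) = wedge (\<Sum>j<k. w j *\<^sub>R unit j) (unit c)"
        using vecs_expansion[OF that] by simp
      also have "\<dots> = (\<Sum>j<k. w j *\<^sub>R wedge (unit j) (unit c))"
        by (simp add: linear_sum[OF linear_wedge_left] linear_scale[OF linear_wedge_left])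
      also have "\<dots> \<in> U"
        using \<open>\<And>j. j < k \<Longrightarrow> wedge (unit j) (unit c) \<in> U\<close>
        by (intro subspace_sum subspace_scale U) auto
      finally show ?thesis .
    qed
    then show ?thesis by (auto simp: spokes_def)
  qed
  then show ?thesis
    unfolding irreducible_Ad_module_def
    by (intro conjI allI impI subspace_spokes nonzero inv) (meson subset_antisym)
qed

lemma irreducible_axle:
  assumes "Suc k < n"
  shows "irreducible_Ad_module n (orth n k) (axle k)"
proof -
  let ?F = "wedge (unit k) (unit (Suc k))"
  have kn: "k \<le> n" using assms by simp
  have F: "?F \<noteq> 0"
  proof
    assume "?F = 0"
    then have "?F k (Suc k) = 0" by simp
    then show False by (simp add: wedge_def) (simp add: unit_def)
  qed
  have sub: "subspace (axle k)"
    unfolding axle_def by (intro linear_subspace_image subspace_UNIV linearI) (simp_all add: scaleR_add_left)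
  have inv: "Ad_invariant n (orth n k) (axle k)"
    using assms by (auto simp: Ad_invariant_def axle_def Ad_scaleR Ad_wedge[OF kn] mat_vec_orth_unit)
  have nonzero: "axle k \<noteq> {0}"
  proof -
    have "1 *\<^sub>R ?F \<in> axle k" unfolding axle_def by (rule rangeI)
    then show ?thesis using F by force
  qed
  have "axle k \<subseteq> U" if U: "subspace U" "U \<subseteq> axle k" "U \<noteq> {0}" for U
  proof -
    obtain s where s: "s *\<^sub>R ?F \<in> U" "s \<noteq> 0"
    proof -
      obtain X where X: "X \<in> U" "X \<noteq> 0" using U subspace_0[OF U(1)] by blast
      then obtain s where "X = s *\<^sub>R ?F" using U by (auto simp: axle_def)
      then show ?thesis using X that[of s] by auto
    qed
    have "r *\<^sub>R ?F \<in> U" for r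
      using subspace_scale[OF U(1) s(1), of "r / s"] s(2) by simp
    then show ?thesis by (auto simp: axle_def)
  qed
  then show ?thesis
    unfolding irreducible_Ad_module_def
    by (intro conjI allI impI sub nonzero inv) (meson subset_antisym)
qed

subsection \<open>The spaces O(k+2)/O(k)\<close>

text \<open>The one-dimensional module gets index 1 so that the parameter 1/2 is a_1, matching
  \<open>wallach_params\<close>.\<close>

definition wallach_space :: "nat \<Rightarrow> homogeneous_space"
  where "wallach_space k = \<lparr>msize = k + 2, grp = orth (k + 2) (k + 2), isot = orth (k + 2) k,
    modl = (\<lambda>i. if i = 1 then axle k else if i = 2 then spokes k k else spokes k (Suc k))\<rparr>"

lemma Lie_wallach_space:
  "Lie_G (wallach_space k) = skew (k + 2)" "Lie_H (wallach_space k) = skew k"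
  by (simp_all add: wallach_space_def lie_algebra_orth)

section \<open>Semisimplicity and almost effectiveness\<close>

text \<open>For X in an abelian ideal, [X, [X, E]] = 0 for every E. Take X_pq nonzero and E = e_p
  wedge e_j with j different from p and q; a third index exists as n \<ge> 3. Entry (p, j) says that
  the squared norms of rows p and j add up to 2 X_pj^2. Row p alone gives at least X_pj^2 + X_pq^2
  and row j at least X_pj^2, so X_pq = 0.\<close>

lemma semisimple_skew:
  assumes "3 \<le> n"
  shows "semisimple n (skew n)"
proof -
  have "I = {0}" if I: "lie_ideal n I (skew n)" and abel: "\<forall>X\<in>I. \<forall>Y\<in>I. bracket n X Y = 0" for I
  proof -
    have "X p q = 0" if "X \<in> I" for X p q
    proof (rule ccontr)
      assume nz: "X p q \<noteq> 0"
      have X: "X \<in> skew n" using that I by (auto simp: lie_ideal_def)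
      have pq: "p < n" "q < n" using nz skew_outside[OF X, of p q] by (auto simp: not_le[symmetric])
      have "p \<noteq> q" using nz skew_diagonal[OF X] by auto
      have "\<not> {0, 1, 2} \<subseteq> {p, q}" by auto
      then obtain j where j: "j \<in> {0, 1, 2}" "j \<notin> {p, q}" by blast
      then have "j < n" using assms by auto
      let ?E = "wedge (unit p) (unit j)"
      have E: "?E \<in> skew n" using pq \<open>j < n\<close> by (intro wedge_in_skew unit_in_vecs)
      have "bracket n ?E X \<in> I" using I E that by (auto simp: lie_ideal_def)
      then have "bracket n X (bracket n ?E X) = 0" using abel that by blast
      moreover have "bracket n X ?E = - bracket n ?E X" by (simp add: bracket_def)
      ultimately have "bracket n X (bracket n X ?E) = 0"
        using linear_neg[OF linear_bracket] by (metis neg_equal_0_iff_equal)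
      then have 0: "bracket n X (bracket n X ?E) p j = 0" by simp
      have sq: "mat_mul n X X i i = - (\<Sum>k<n. (X i k)\<^sup>2)" for i
      proof -
        have "X i k * X k i = - (X i k)\<^sup>2" for k
          using skew_swap[OF X, of k i] by (simp add: power2_eq_square)
        then show ?thesis by (simp add: mat_mul_def sum_negf)
      qed
      have "unit p j = 0" using j by (auto simp: unit_def)
      then have "(\<Sum>k<n. (X p k)\<^sup>2) + (\<Sum>k<n. (X j k)\<^sup>2) = 2 * (X p j)\<^sup>2"
        using 0 double_bracket_entry[OF X X pq(1) \<open>j < n\<close>] by (simp add: sq power2_eq_square)
      moreover have "(X p j)\<^sup>2 + (X p q)\<^sup>2 \<le> (\<Sum>k<n. (X p k)\<^sup>2)"
        using sum_mono2[of "{..<n}" "{j, q}" "\<lambda>k. (X p k)\<^sup>2"] j \<open>j < n\<close> pq by simp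
      moreover have "(X p j)\<^sup>2 \<le> (\<Sum>k<n. (X j k)\<^sup>2)"
        using member_le_sum[of p "{..<n}" "\<lambda>k. (X j k)\<^sup>2"] pq skew_swap[OF X, of p j] by simp
      ultimately have "(X p q)\<^sup>2 \<le> 0" by linarith
      then show False using nz by simp
    qed
    then have "I \<subseteq> {0}" by (auto simp: fun_eq_iff)
    moreover have "0 \<in> I" using I by (auto simp: lie_ideal_def intro: subspace_0)
    ultimately show ?thesis by blast
  qed
  then show ?thesis by (auto simp: semisimple_def)
qed

text \<open>The bracket with e_p wedge e_k copies column p of X, up to sign, into column k. That
  column lies outside the block of so(k), so it must vanish if the bracket stays in the
  ideal.\<close>

lemma ideal_in_isotropy_trivial:
  assumes I: "lie_ideal (k + 2) I (skew (k + 2))" and "I \<subseteq> skew k"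
  shows "I = {0}"
proof -
  let ?n = "k + 2"
  have "X i p = 0" if "X \<in> I" for X i p
  proof (cases "p < k")
    case True
    have X: "X \<in> skew k" using that assms by blast
    let ?E = "wedge (unit p) (unit k)"
    have "?E \<in> skew ?n" using True by (intro wedge_in_skew unit_in_vecs) auto
    then have "bracket ?n ?E X \<in> skew k" using assms that by (auto simp: lie_ideal_def)
    then have "bracket ?n ?E X i k = 0" by (rule skew_outside) simp
    moreover have "mat_mul ?n ?E X i k = 0" using X by (simp add: mat_mul_def skew_outside)
    moreover have "mat_mul ?n X ?E i k = X i p"
      using True by (simp add: mat_mul_wedge mat_vec_unit skew_outside[OF X])
    ultimately show ?thesis by (simp add: bracket_def)
  next
    case False
    then show ?thesis using that assms skew_outside[of X k i p] by auto
  qed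
  then have "I \<subseteq> {0}" by (auto simp: fun_eq_iff)
  moreover have "0 \<in> I" using I by (auto simp: lie_ideal_def intro: subspace_0)
  ultimately show ?thesis by blast
qed

section \<open>The complement of the isotropy algebra and its three modules\<close>

lemma orth_complement_skew:
  assumes "0 < k"
  shows "orth_complement (k + 2) (skew (k + 2)) (skew k) =
    {X \<in> skew (k + 2). \<forall>i<k. \<forall>j<k. X i j = 0}"
proof -
  let ?n = "k + 2"
  have ip: "ip ?n (skew ?n) X Y = real k * (\<Sum>i<?n. \<Sum>j<?n. X i j * Y i j)"
    if "X \<in> skew ?n" "Y \<in> skew k" for X Y
    using that skew_mono[of k ?n] ip_skew[of X ?n Y] by auto
  have "X i j = 0" if X: "X \<in> skew ?n" and orth: "\<forall>Y\<in>skew k. ip ?n (skew ?n) X Y = 0"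
    and ij: "i < k" "j < k" for X i j
  proof -
    \<comment> \<open>X is tested against its own truncation to the k x k block; the inner product
      is then k times the sum of the squared entries of that block.\<close>
    define Y where "Y = (\<lambda>i j. if i < k \<and> j < k then X i j else 0)"
    have Y: "Y \<in> skew k"
    proof (rule skewI)
      show "Y j i = - Y i j" for i j using skew_swap[OF X, of i j] by (simp add: Y_def)
    qed (auto simp: mats_def Y_def)
    have XY: "0 \<le> X i j * Y i j" for i j by (simp add: Y_def)
    have "(\<Sum>i<?n. \<Sum>j<?n. X i j * Y i j) = 0"
      using orth Y ip[OF X Y] assms by simp
    then have "(\<Sum>j<?n. X i j * Y i j) = 0"
      by (rule sum_nonneg_0[rotated 2]) (use ij in \<open>auto intro: sum_nonneg XY simp del: sum.lessThan_Suc\<close>)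
    then have "X i j * Y i j = 0"
      by (rule sum_nonneg_0[rotated 2]) (use ij in \<open>auto intro: XY\<close>)
    then show ?thesis using ij by (simp add: Y_def)
  qed
  moreover have "ip ?n (skew ?n) X Y = 0"
    if X: "X \<in> skew ?n" "\<forall>i<k. \<forall>j<k. X i j = 0" and Y: "Y \<in> skew k" for X Y
  proof -
    have "X i j * Y i j = 0" for i j
      using X(2) skew_outside[OF Y, of i j] by (cases "i < k \<and> j < k") auto
    then show ?thesis by (simp only: ip[OF X(1) Y] sum.neutral_const mult_zero_right)
  qed
  ultimately show ?thesis by (auto simp: orth_complement_def)
qed

lemma modl_wallach_cases:
  assumes "X \<in> modl (wallach_space k) i"
  obtains s where "i = 1" "X = s *\<^sub>R wedge (unit k) (unit (Suc k))"
  | v where "i = 2" "v \<in> vecs k" "X = wedge v (unit k)"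
  | v where "i = 3" "v \<in> vecs k" "X = wedge v (unit (Suc k))"
  using assms exhaust_3[of i]
  by (auto simp: wallach_space_def axle_def spokes_def split: if_splits)

lemma modl_wallach_subset:
  "modl (wallach_space k) i \<subseteq> {X \<in> skew (k + 2). \<forall>i<k. \<forall>j<k. X i j = 0}"
proof
  fix X assume "X \<in> modl (wallach_space k) i"
  moreover have W: "wedge v (unit c) \<in> {X \<in> skew (k + 2). \<forall>i<k. \<forall>j<k. X i j = 0}"
    if "c < k + 2" "k \<le> c" "v \<in> vecs (k + 2)" for v c
  proof -
    have "wedge v (unit c) \<in> skew (k + 2)" using that by (intro wedge_in_skew unit_in_vecs)
    moreover have "\<forall>i<k. \<forall>j<k. wedge v (unit c) i j = 0" using that by (auto simp: wedge_def unit_def)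
    ultimately show ?thesis by blast
  qed
  have "vecs k \<subseteq> vecs (k + 2)" by (rule vecs_mono) simp
  with W have "wedge v (unit c) \<in> {X \<in> skew (k + 2). \<forall>i<k. \<forall>j<k. X i j = 0}"
    if "c < k + 2" "k \<le> c" "v \<in> vecs k" for v c using that by blast
  ultimately show "X \<in> {X \<in> skew (k + 2). \<forall>i<k. \<forall>j<k. X i j = 0}"
    using W[of "Suc k" "unit k"]
    by (cases rule: modl_wallach_cases) (auto simp: unit_in_vecs intro!: subspace_scale[OF subspace_skew])
qed

text \<open>The inner product is a multiple of the entrywise one, so orthogonality of the modules
  reduces to their occupying different matrix positions.\<close>

lemma modl_wallach_disjoint_support:
  assumes "X \<in> modl (wallach_space k) i" "Y \<in> modl (wallach_space k) j" "i \<noteq> j"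
  shows "X p q * Y p q = 0"
  using assms(1,2)
  by (elim modl_wallach_cases; use assms(3) in simp) (auto simp: wedge_def unit_def vecs_def)

lemma complement_decomposition:
  "{X \<in> skew (k + 2). \<forall>i<k. \<forall>j<k. X i j = 0} =
    {X 1 + X 2 + X 3 | X. \<forall>i. X i \<in> modl (wallach_space k) i}" (is "?L = ?R")
proof (intro equalityI subsetI)
  fix X assume "X \<in> ?L"
  then have X: "X \<in> skew (k + 2)" and 0: "\<And>i j. i < k \<Longrightarrow> j < k \<Longrightarrow> X i j = 0" by auto
  \<comment> \<open>The part of column \<open>c\<close> above row k. Together with its transpose it
    is a spoke, and columns k and k + 1 with the single entry (k, k + 1) determine X.\<close>
  define v where "v c = (\<lambda>i. if i < k then X i c else 0)" for c
  define Z :: "3 \<Rightarrow> rmat" where "Z i = (if i = 1 then X k (Suc k) *\<^sub>R wedge (unit k) (unit (Suc k))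
     else if i = 2 then wedge (v k) (unit k) else wedge (v (Suc k)) (unit (Suc k)))" for i
  have "v c \<in> vecs k" for c by (simp add: v_def vecs_def)
  then have Z: "Z i \<in> modl (wallach_space k) i" for i
    by (auto simp: wallach_space_def Z_def axle_def spokes_def)
  have "X p q = (Z 1 + Z 2 + Z 3) p q" for p q
  proof -
    have swap: "q < k \<Longrightarrow> X k q = - X q k" "q < k \<Longrightarrow> X (Suc k) q = - X q (Suc k)"
      "X (Suc k) k = - X k (Suc k)"
      using skew_swap[OF X] by blast+
    have out: "X i j = 0" if "k + 2 \<le> i \<or> k + 2 \<le> j" for i j by (rule skew_outside[OF X that])
    have p: "p < k \<or> p = k \<or> p = Suc k \<or> k + 2 \<le> p" and q: "q < k \<or> q = k \<or> q = Suc k \<or> k + 2 \<le> q"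
      by linarith+
    show ?thesis
      using p q
      by (elim disjE) (simp_all add: swap out 0 skew_diagonal[OF X] Z_def wedge_def unit_def v_def)
  qed
  then have "X = Z 1 + Z 2 + Z 3" by (intro ext)
  then show "X \<in> ?R" using Z by blast
next
  fix X assume "X \<in> ?R"
  then obtain Z where X: "X = Z 1 + Z 2 + Z 3" and Z: "\<forall>i. Z i \<in> modl (wallach_space k) i" by blast
  then have "Z i \<in> ?L" for i using modl_wallach_subset[of k i] by blast
  then show "X \<in> ?L" unfolding X by (auto intro!: subspace_add[OF subspace_skew])
qed

lemma generalized_wallach_space_wallach:
  assumes "0 < k"
  shows "generalized_wallach_space (wallach_space k)"
proof -
  let ?n = "k + 2"
  let ?W = "wallach_space k"
  have irr: "irreducible_Ad_module ?n (orth ?n k) (modl ?W i)" for i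
    using assms by (auto simp: wallach_space_def intro!: irreducible_axle irreducible_spokes)
  have br: "bracket ?n X Y \<in> skew k" if "X \<in> modl ?W i" "Y \<in> modl ?W i" for i X Y
  proof -
    \<comment> \<open>The two vectors have no component along e_c, so the contraction leaves only
      the pairing of e_c with itself, and the bracket falls into so(k).\<close>
    have spokes: "bracket ?n (wedge v (unit c)) (wedge w (unit c)) \<in> skew k"
      if vw: "v \<in> vecs k" "w \<in> vecs k" and c: "k \<le> c" "c < ?n" for v w c
    proof -
      have "v c = 0" "w c = 0" using vw c by (auto simp: vecs_def)
      then have "bracket ?n (wedge v (unit c)) (wedge w (unit c)) = - wedge v w"
        using c by (simp add: bracket_wedge dot_unit)
      then show ?thesis using vw by (simp add: subspace_neg[OF subspace_skew] wedge_in_skew)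
    qed
    have "bracket ?n (s *\<^sub>R F) (t *\<^sub>R F) = 0" for s t F
      by (simp add: bracket_def mat_mul_scaleR mult.commute)
    then show ?thesis
      using that spokes subspace_0[OF subspace_skew, of k] by (elim modl_wallach_cases) auto
  qed
  have orth: "ip ?n (skew ?n) X Y = 0" if "i \<noteq> j" "X \<in> modl ?W i" "Y \<in> modl ?W j" for i j X Y
  proof -
    have "X \<in> skew ?n" "Y \<in> skew ?n" using that modl_wallach_subset by blast+
    then show ?thesis using that by (simp add: ip_skew modl_wallach_disjoint_support)
  qed
  have W: "msize ?W = ?n" "grp ?W = orth ?n ?n" "isot ?W = orth ?n k"
    by (simp_all add: wallach_space_def)
  have lie: "lie_algebra ?n (orth ?n ?n) = skew ?n" "lie_algebra ?n (orth ?n k) = skew k"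
    by (simp_all add: lie_algebra_orth)
  show ?thesis
    unfolding generalized_wallach_space_def Let_def W lie
  proof (intro conjI allI ballI impI)
    show "compact_lie_group ?n (orth ?n ?n)"
      by (simp add: compact_lie_group_def mat_group_orth compact_orth)
    show "closed_subgroup ?n (orth ?n k) (orth ?n ?n)"
      by (simp add: closed_subgroup_def mat_group_orth orth_mono closed_orth)
    show "semisimple ?n (skew ?n)" using assms by (intro semisimple_skew) simp
    show "orth_complement ?n (skew ?n) (skew k) = {X 1 + X 2 + X 3 | X. \<forall>i. X i \<in> modl ?W i}"
      unfolding orth_complement_skew[OF assms] by (rule complement_decomposition)
    show "I = {0}" if "lie_ideal ?n I (skew ?n) \<and> I \<subseteq> skew k" for I
      using that by (intro ideal_in_isotropy_trivial) auto
  qed (fact irr br orth)+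
qed

section \<open>Dimension as an isomorphism invariant\<close>

text \<open>The map is defined on the whole ambient space but known to be injective only on
  \<open>V\<close>, so a basis of \<open>V\<close> is transported by hand.\<close>

lemma dim_eq_linear_bij:
  assumes \<phi>: "linear \<phi>" "bij_betw \<phi> V V'" and V: "subspace V"
  shows "dim V' = dim V"
proof -
  obtain B where B: "B \<subseteq> V" "independent B" "V \<subseteq> span B" "card B = dim V"
    by (rule basis_exists)
  then have span: "span B = V" using V by (intro span_subspace)
  have inj: "inj_on \<phi> (span B)" and img: "\<phi> ` V = V'" using \<phi>(2) span by (auto simp: bij_betw_def)
  have "independent (\<phi> ` B)" by (rule linear_independent_injective_image[OF \<phi>(1) B(2) inj])
  moreover have "span (\<phi> ` B) = span V'"
    using linear_span_image[OF \<phi>(1), of B] span img V span_span by metis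
  ultimately have "dim V' = card (\<phi> ` B)" by (intro dim_eq_card)
  also have "\<dots> = card B" using inj span_superset by (metis card_image inj_on_subset)
  finally show ?thesis using B by simp
qed

lemma dim_skew: "dim (skew n) = card {(i, j). i < j \<and> j < n}"
proof -
  let ?I = "{(i, j). i < j \<and> j < n}"
  let ?e = "\<lambda>ij. wedge (unit (fst ij)) (unit (snd ij))"
  have fin: "finite ?I" by (rule finite_subset[of _ "{..<n} \<times> {..<n}"]) auto
  have ind: "inj_on ?e ?I" "independent (?e ` ?I)"
    by (rule dual_family_independent[OF fin, where c = "\<lambda>ij X. 1 * X (fst ij) (snd ij)"],
        rule linear_scaled_entry, force simp: wedge_def unit_def)+
  have "?e ` ?I \<subseteq> skew n" by (auto intro!: wedge_in_skew unit_in_vecs)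
  moreover have "skew n \<subseteq> span (?e ` ?I)"
  proof
    fix X assume X: "X \<in> skew n"
    have "wedge (unit i) (unit j) \<in> span (?e ` ?I)" if "i < n" "j < n" for i j
    proof -
      consider "i < j" | "i = j" | "j < i" by linarith
      then show ?thesis
      proof cases
        case 1
        then show ?thesis using that by (intro span_base) force
      next
        case 2
        then show ?thesis by (simp add: span_zero)
      next
        case 3
        then have "wedge (unit j) (unit i) \<in> span (?e ` ?I)" using that by (intro span_base) force
        moreover have "wedge (unit i) (unit j) = - wedge (unit j) (unit i)"
          by (simp add: wedge_def fun_eq_iff)
        ultimately show ?thesis by (simp add: span_neg)
      qed
    qed
    then show "X \<in> span (?e ` ?I)"
      by (subst skew_expansion[OF X], intro span_sum) (auto intro!: span_scale)
  qed
  ultimately have "dim (skew n) = card (?e ` ?I)" using ind by (intro dim_unique) auto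
  then show ?thesis using ind by (simp add: card_image)
qed

lemma dim_skew_strict_mono:
  assumes "0 < m" "m < n"
  shows "dim (skew m) < dim (skew n)"
  unfolding dim_skew
proof (rule psubset_card_mono)
  show "finite {(i, j). i < j \<and> j < n}" by (rule finite_subset[of _ "{..<n} \<times> {..<n}"]) auto
  have "(0, m) \<in> {(i, j). i < j \<and> j < n}" "(0, m) \<notin> {(i, j). i < j \<and> j < m}" using assms by auto
  then show "{(i, j). i < j \<and> j < m} \<subset> {(i, j). i < j \<and> j < n}" using assms by auto
qed

text \<open>An isomorphism of pairs preserves the dimension of the larger algebra, and dim so(n)
  grows strictly with n.\<close>

lemma wallach_spaces_not_isomorphic:
  assumes "k \<noteq> l"
  shows "\<not> pair_isomorphic (wallach_space k) (wallach_space l)"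
proof
  assume "pair_isomorphic (wallach_space k) (wallach_space l)"
  then obtain \<phi> where "linear \<phi>" "bij_betw \<phi> (skew (k + 2)) (skew (l + 2))"
    unfolding pair_isomorphic_def Lie_wallach_space by blast
  then have "dim (skew (l + 2)) = dim (skew (k + 2))"
    using subspace_skew by (rule dim_eq_linear_bij)
  then show False
    using dim_skew_strict_mono[of "k + 2" "l + 2"] dim_skew_strict_mono[of "l + 2" "k + 2"] assms
    by (cases "k < l") auto
qed

section \<open>Orthonormal bases and the structure constant A\<close>

lemma
  assumes "k \<le> c" "s \<noteq> 0"
  shows inj_scaled_spokes: "inj_on (\<lambda>i. s *\<^sub>R wedge (unit i) (unit c)) {..<k}"
    and independent_scaled_spokes: "independent ((\<lambda>i. s *\<^sub>R wedge (unit i) (unit c)) ` {..<k})"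
  by (rule dual_family_independent[where c = "\<lambda>i X. (1 / s) * X i c"],
      simp, rule linear_scaled_entry, use assms in \<open>force simp: wedge_def unit_def\<close>)+

lemma span_scaled_spokes:
  assumes "s \<noteq> 0"
  shows "span ((\<lambda>i. s *\<^sub>R wedge (unit i) (unit c)) ` {..<k}) = spokes k c" (is "span ?E = _")
proof
  have "?E \<subseteq> spokes k c"
    by (auto simp: spokes_def intro!: subspace_scale[OF subspace_spokes, unfolded spokes_def] unit_in_vecs)
  then show "span ?E \<subseteq> spokes k c" by (intro span_minimal subspace_spokes)
  have "wedge v (unit c) \<in> span ?E" if "v \<in> vecs k" for v
  proof -
    have "wedge v (unit c) = wedge (\<Sum>i<k. v i *\<^sub>R unit i) (unit c)"
      using vecs_expansion[OF that] by simp
    also have "\<dots> = (\<Sum>i<k. (v i / s) *\<^sub>R (s *\<^sub>R wedge (unit i) (unit c)))"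
      using assms by (simp add: linear_sum[OF linear_wedge_left] linear_scale[OF linear_wedge_left])
    also have "\<dots> \<in> span ?E" by (intro span_sum span_scale span_base) auto
    finally show ?thesis .
  qed
  then show "spokes k c \<subseteq> span ?E" by (auto simp: spokes_def)
qed

lemma dim_spokes:
  assumes "k \<le> c"
  shows "dim (spokes k c) = k"
proof -
  let ?E = "(\<lambda>i. 1 *\<^sub>R wedge (unit i) (unit c)) ` {..<k}"
  have "dim (spokes k c) = card ?E"
    using span_scaled_spokes[of 1 c k] independent_scaled_spokes[OF assms, of 1]
    by (intro dim_eq_card) (metis span_span zero_neq_one, simp)
  also have "\<dots> = k" using inj_scaled_spokes[OF assms, of 1] by (simp add: card_image)
  finally show ?thesis .
qed

lemma span_scaled_axle:
  assumes "s \<noteq> 0"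
  shows "span {s *\<^sub>R wedge (unit k) (unit (Suc k))} = axle k" (is "span {s *\<^sub>R ?F} = _")
  unfolding span_singleton axle_def
proof (intro subset_antisym image_subsetI)
  show "r *\<^sub>R s *\<^sub>R ?F \<in> range (\<lambda>r. r *\<^sub>R ?F)" for r
    by (rule range_eqI[of _ _ "r * s"]) simp
  show "r *\<^sub>R ?F \<in> range (\<lambda>r. r *\<^sub>R s *\<^sub>R ?F)" for r
    using assms by (intro range_eqI[of _ _ "r / s"]) simp
qed

lemma wedge_unit_nonzero: "i \<noteq> j \<Longrightarrow> wedge (unit i) (unit j) \<noteq> 0"
proof
  assume "i \<noteq> j" "wedge (unit i) (unit j) = 0"
  then have "wedge (unit i) (unit j) i j = 0" by simp
  then show False using \<open>i \<noteq> j\<close> by (simp add: wedge_def) (simp add: unit_def)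
qed

lemma dim_axle: "dim (axle k) = 1"
proof -
  let ?F = "wedge (unit k) (unit (Suc k))"
  have axle: "span {?F} = axle k" using span_scaled_axle[of 1 k] by simp
  have "span {?F} = span (axle k)" unfolding axle[symmetric] by (rule span_span[symmetric])
  moreover have "independent {?F}"
    using wedge_unit_nonzero[of k "Suc k"] by simp
  ultimately have "dim (axle k) = card {?F}" by (rule dim_eq_card)
  then show ?thesis by simp
qed

lemma unit_commute: "unit i j = unit j i"
  by (simp add: unit_def)

lemma ip_scaled_wedge_unit:
  assumes "0 < k" "i < k + 2" "j < k + 2" "p < k + 2" "q < k + 2"
  shows "ip (k + 2) (skew (k + 2)) (r *\<^sub>R wedge (unit i) (unit j)) (s *\<^sub>R wedge (unit p) (unit q)) =
    2 * real k * r * s * (unit i p * unit j q - unit i q * unit j p)"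
proof -
  have "ip (k + 2) (skew (k + 2)) (wedge (r *\<^sub>R unit i) (unit j)) (wedge (s *\<^sub>R unit p) (unit q)) =
      2 * real k * (r * s * unit i p * unit j q - r * unit i q * (s * unit j p))"
    using assms
    by (subst ip_wedge, auto simp: unit_in_vecs subspace_scale[OF subspace_vecs] dot_def
        sum_distrib_left[symmetric] mult.assoc simp del: sum.lessThan_Suc)
      (simp add: unit_commute[of p] unit_commute[of q])
  then show ?thesis by (simp add: linear_scale[OF linear_wedge_left] algebra_simps)
qed

lemma gws_parameters_wallach:
  assumes "0 < k"
  shows "gws_parameters (wallach_space k) (wallach_params k)"
proof -
  let ?n = "k + 2"
  \<comment> \<open>With n - 2 = k, a wedge of two distinct unit vectors has squared length 2 k;
    \<open>s\<close> normalizes it.\<close>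
  define s where "s = 1 / sqrt (2 * real k)"
  have s: "s \<noteq> 0" "2 * real k * s * s = 1" using assms by (simp_all add: s_def)
  define F where "F i c = s *\<^sub>R wedge (unit i) (unit c)" for i c
  have ip_F: "ip ?n (skew ?n) (F i j) (F p q) = unit i p * unit j q - unit i q * unit j p"
    if "i < ?n" "j < ?n" "p < ?n" "q < ?n" for i j p q
    unfolding F_def ip_scaled_wedge_unit[OF assms that] by (simp add: s)
  define E :: "3 \<Rightarrow> rmat set" where "E i = (if i = 1 then {F k (Suc k)} else
    if i = 2 then (\<lambda>i. F i k) ` {..<k} else (\<lambda>i. F i (Suc k)) ` {..<k})" for i
  have basis: "orthonormal_basis ?n (skew ?n) (modl (wallach_space k) i) (E i)" for i
  proof -
    have "orthonormal_basis ?n (skew ?n) (axle k) {F k (Suc k)}"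
      using span_scaled_axle[OF s(1), of k] ip_F[of k "Suc k" k "Suc k"]
      by (simp add: orthonormal_basis_def F_def) (simp add: unit_def)
    moreover have "orthonormal_basis ?n (skew ?n) (spokes k c) ((\<lambda>i. F i c) ` {..<k})"
      if "k \<le> c" "c < ?n" for c
      unfolding orthonormal_basis_def
    proof (intro conjI ballI)
      show "span ((\<lambda>i. F i c) ` {..<k}) = spokes k c" unfolding F_def by (rule span_scaled_spokes[OF s(1)])
      fix e f assume "e \<in> (\<lambda>i. F i c) ` {..<k}" "f \<in> (\<lambda>i. F i c) ` {..<k}"
      then obtain i j where ij: "i < k" "j < k" "e = F i c" "f = F j c" by blast
      then have "e = f \<longleftrightarrow> i = j"
        using inj_scaled_spokes[OF that(1) s(1)] by (auto simp: F_def inj_on_def)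
      then show "ip ?n (skew ?n) e f = (if e = f then 1 else 0)"
        using ij that ip_F[of i c j c] by (auto simp: unit_def)
    qed simp
    ultimately show ?thesis by (simp add: wallach_space_def E_def)
  qed
  \<comment> \<open>The bracket is s^2 e_(k+1) wedge e_i, which meets only the basis vector with j =
    i, with inner product -s. Each of the k diagonal pairs thus contributes s^2 = 1/(2k), so A =
    1/2, and dividing by the dimensions 1, k, k gives the parameters.\<close>
  have summand: "(ip ?n (skew ?n) (bracket ?n (F k (Suc k)) (F i k)) (F j (Suc k)))\<^sup>2 = unit i j * (1 / (2 * real k))"
    if ij: "i < k" "j < k" for i j
  proof -
    have "bracket ?n (F k (Suc k)) (F i k) =
        (s * s) *\<^sub>R bracket ?n (wedge (unit k) (unit (Suc k))) (wedge (unit i) (unit k))"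
      by (simp add: bracket_def F_def mat_mul_scaleR scaleR_diff_right)
    also have "bracket ?n (wedge (unit k) (unit (Suc k))) (wedge (unit i) (unit k)) = wedge (unit (Suc k)) (unit i)"
      using ij by (simp add: bracket_wedge dot_unit) (simp add: unit_def)
    finally have "ip ?n (skew ?n) (bracket ?n (F k (Suc k)) (F i k)) (F j (Suc k)) =
        2 * real k * (s * s) * s * (unit (Suc k) j * unit i (Suc k) - unit (Suc k) (Suc k) * unit i j)"
      unfolding F_def[of j] using ij by (simp only:) (rule ip_scaled_wedge_unit[OF assms]; simp)
    also have "\<dots> = (2 * real k * s * s) * s * - unit i j" using ij by (simp add: unit_def)
    also have "\<dots> = - s * unit i j" by (simp add: s)
    finally have "(ip ?n (skew ?n) (bracket ?n (F k (Suc k)) (F i k)) (F j (Suc k)))\<^sup>2 = s\<^sup>2 * (unit i j)\<^sup>2"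
      by (simp add: power_mult_distrib)
    also have "s\<^sup>2 = 1 / (2 * real k)" by (simp add: s_def power_divide)
    finally show ?thesis by (simp add: unit_def)
  qed
  have inj: "inj_on (\<lambda>i. F i k) {..<k}" "inj_on (\<lambda>i. F i (Suc k)) {..<k}"
    unfolding F_def using s by (auto intro: inj_scaled_spokes)
  have "(\<Sum>e1\<in>E 1. \<Sum>e2\<in>E 2. \<Sum>e3\<in>E 3. (ip ?n (skew ?n) (bracket ?n e1 e2) e3)\<^sup>2) =
      (\<Sum>i<k. \<Sum>j<k. (ip ?n (skew ?n) (bracket ?n (F k (Suc k)) (F i k)) (F j (Suc k)))\<^sup>2)"
    by (simp add: E_def sum.reindex[OF inj(1)] sum.reindex[OF inj(2)])
  also have "\<dots> = (\<Sum>i<k. \<Sum>j<k. unit i j * (1 / (2 * real k)))"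
    by (intro sum.cong refl summand) auto
  also have "\<dots> = (\<Sum>i<k. 1 / (2 * real k))"
    by (simp only: sum_unit) (intro sum.cong; simp)
  also have "\<dots> = 1 / 2" using assms by simp
  finally have A: "(\<Sum>e1\<in>E 1. \<Sum>e2\<in>E 2. \<Sum>e3\<in>E 3. (ip ?n (skew ?n) (bracket ?n e1 e2) e3)\<^sup>2) = 1 / 2" .
  have dims: "wallach_params k $ i = 1 / 2 / real (dim (modl (wallach_space k) i))" for i
    by (simp add: wallach_params_def wallach_space_def dim_axle dim_spokes)
  have W: "msize (wallach_space k) = ?n" "grp (wallach_space k) = orth ?n ?n"
    by (simp_all add: wallach_space_def)
  have "0 < wallach_params k $ i \<and> wallach_params k $ i \<le> 1 / 2" for i
    using assms by (simp add: wallach_params_def divide_simps)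
  then show ?thesis
    unfolding gws_parameters_def Let_def W lie_algebra_orth[OF order_refl]
    by (intro conjI exI[of _ E] allI basis) (simp_all only: A dims)
qed

theorem theorem2:
  shows "\<exists>S :: homogeneous_space set.
    infinite S \<and>
    (\<forall>W\<in>S. \<forall>W'\<in>S. W \<noteq> W' \<longrightarrow> \<not> pair_isomorphic W W') \<and>
    (\<forall>W\<in>S. generalized_wallach_space W \<and>
      (\<exists>a. gws_parameters W a \<and>
        (\<forall>x0 T x. x0 \<in> ricci_positive a \<and> generic x0 \<and> maximal_nrf_solution a x0 T x \<longrightarrow>
          (\<forall>t. 0 < t \<and> ereal t < T \<longrightarrow> x t \<in> ricci_positive a))))"
\<comment> \<open>The bound k > 1 comes from the flow estimate, where k^2 > 1 separates the two
  sheets of the cone.\<close>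
proof (intro exI[of _ "wallach_space ` {1<..}"] conjI ballI impI)
  let ?S = "wallach_space ` {1<..}"
  have "inj_on wallach_space {1<..}"
  proof (rule inj_onI)
    fix k l assume "wallach_space k = wallach_space l"
    then have "msize (wallach_space k) = msize (wallach_space l)" by (rule arg_cong)
    then show "k = l" by (simp add: wallach_space_def)
  qed
  then show "infinite ?S" using finite_imageD[of wallach_space] infinite_Ioi by blast
  show "\<not> pair_isomorphic W W'" if "W \<in> ?S" "W' \<in> ?S" "W \<noteq> W'" for W W'
  proof -
    obtain k l where "W = wallach_space k" "W' = wallach_space l" using \<open>W \<in> ?S\<close> \<open>W' \<in> ?S\<close> by blast
    then show ?thesis using \<open>W \<noteq> W'\<close> wallach_spaces_not_isomorphic[of k l] by blast
  qed
  fix W assume "W \<in> ?S"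
  then obtain k where k: "1 < k" "W = wallach_space k" by auto
  show "generalized_wallach_space W" using k by (simp add: generalized_wallach_space_wallach)
  show "\<exists>a. gws_parameters W a \<and>
      (\<forall>x0 T x. x0 \<in> ricci_positive a \<and> generic x0 \<and> maximal_nrf_solution a x0 T x \<longrightarrow>
        (\<forall>t. 0 < t \<and> ereal t < T \<longrightarrow> x t \<in> ricci_positive a))"
  proof (intro exI[of _ "wallach_params k"] conjI allI impI; (elim conjE)?)
    show "gws_parameters W (wallach_params k)" using k by (simp add: gws_parameters_wallach)
    fix x0 T x t
    assume "x0 \<in> ricci_positive (wallach_params k)" "maximal_nrf_solution (wallach_params k) x0 T x"
      and "0 < t" "ereal t < T"
    then show "x t \<in> ricci_positive (wallach_params k)"
      by (auto intro: ricci_positive_preserved[OF k(1)] simp: maximal_nrf_solution_def)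
  qed
qed

end
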